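(* Let $m,n$ be nonnegative integers, $I\subseteq[m-1]$ and $J\subseteq[n-1]$. Choose arbitrary permutations $u\in\mathfrak S_m$ and $v\in\mathfrak S_n$ with $\mathrm{Des}(u)=I$ and $\mathrm{Des}(v)=J$. Then $$G_I(q)G_J(q)=\sum_{w\in u\,\sqcup\!\sqcup\,v[m]}c_{w;m}\sum_{K:\ \mathrm{Des}(w)\subseteq K\subseteq[m+n-1]}\left(\prod_{i\in K\setminus\mathrm{Des}(w)}\big(q^{\mathrm{wt}_K(i)}-\mathrm{sw}^w_m(i)\big)\right)G_K(q),$$ where $$c_{w;m}=\left(\prod_{i\in\mathrm{sDes}(w^0_{\le m})\setminus I}\big(1-q^{\mathrm{wt}_I(i)}\big)\right)\left(\prod_{i\in\mathrm{sDes}(w^0_{>m})\setminus J}\big(1-q^{\mathrm{wt}_J(i)}\big)\right).$$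
   Context: Notation: $[k]=\{1,\dots,k\}$ for $k\ge1$ and $[k]=\emptyset$ for $k\le 0$. For $n\ge1$, $I=\{s_1<\dots<s_i\}\subseteq[n-1]$ corresponds to the composition $\mathrm{comp}(I)=(s_1,s_2-s_1,\dots,n-s_i)$ of $n$; for $n=0$ it is the empty composition. $L_I=L_{\mathrm{comp}(I)}=\sum_{I\subseteq J\subseteq[n-1]}M_{\mathrm{comp}(J)}$ is the fundamental quasisymmetric function, where $M_\alpha=\sum_{i_1<\dots<i_l}x_{i_1}^{\alpha_1}\cdots x_{i_l}^{\alpha_l}$. For $I\subseteq[n-1]$ let $\mathrm{wt}_I(i)=|[1,i-1]\cap I|+1$ for $i\in[n-1]$. Hivert's quasisymmetric Hall--Littlewood function $G_I(q)=G_{\mathrm{comp}(I)}(q)\in\mathrm{QSym}_{\mathbb C(q)}$ (degree $n$) is given by $$G_I(q)=\sum_{I\subseteq J\subseteq[n-1]}(-1)^{|J\setminus I|}q^{s(I,J)}L_J,\qquad s(I,J)=\sum_{i\in J\setminus I}\mathrm{wt}_I(i).$$ Permutations are identified with words $w(1)w(2)\cdots$; for a word $w=w_1\cdots w_N$ of nonnegative integers $\mathrm{Des}(w)=\{i\in[N-1]: w_i>w_{i+1}\}$. For $v\in\mathfrak S_n$, $v[m]$ is the word $(v_1+m)\cdots(v_n+m)$, and $u\,\sqcup\!\sqcup\,v[m]$ is the set of all words of length $m+n$ (permutations in $\mathfrak S_{m+n}$) containing $u$ and $v[m]$ as complementary subwords. For $w\in\mathfrak S_{m+n}$, $w_{\le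 m}$ (resp. $w_{>m}$) is the subword of entries in $[m]$ (resp. in $[m+n]\setminus[m]$); $w^0_{\le m}$ (resp. $w^0_{>m}$) is the word of length $m+n$ obtained from $w$ by replacing every entry $>m$ (resp. $\le m$) by $0$. For a word $x$ of nonnegative integers of length $m+n$, let $P_x=\{i: x_i\ne0\}$, let $\mathrm{std}_{P_x}:P_x\to[|P_x|]$ be the order-preserving bijection (note $\mathrm{Des}(x)\subseteq P_x$), and $\mathrm{sDes}(x)=\mathrm{std}_{P_x}(\mathrm{Des}(x))\setminus\{|P_x|\}$. Let $\mathrm{pos}_{(w;m)}(i)$ be the position of the letter $w(i)$ in the word $w_{\le m}$ if $w(i)\le m$, and in the word $w_{>m}$ if $w(i)>m$. The standardized $q$-weight $\mathrm{sw}^w_m:[m+n-1]\to\mathbb C(q)$ is $$\mathrm{sw}^w_m(i)=\begin{cases}q^{\mathrm{wt}_{\mathrm{Des}(w_{\le m})}(\mathrm{pos}_{(w;m)}(i))}&\text{if }w(i)\le m,\ w(i+1)\le m,\\ q^{\mathrm{wt}_{\mathrm{Des}(w_{>m})}(\mathrm{pos}_{(w;m)}(i))}&\text{if }w(i)>m,\ w(i+1)>m,\\ 0&\text{otherwise.}\end{cases}$$ *)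

theory Defs
  imports
    Complex_Main
    "HOL-Library.Poly_Mapping"
    "HOL-Computational_Algebra.Polynomial"
    "HOL-Computational_Algebra.Fraction_Field"
    "HOL-Combinatorics.Multiset_Permutations"
begin

section \<open>Formal power series in countably many variables\<close>

text \<open>
  A monomial is its exponent vector, a finitely supported function \<open>nat \<Rightarrow>\<^sub>0 nat\<close>; the
  variables are indexed by \<open>nat\<close> in its usual order (starting at \<open>0\<close> rather than \<open>1\<close>).
  Quasisymmetric functions are particular elements of this ring, and \<open>QSym\<close> is a
  subring of it, so that identities in \<open>QSym\<close> are identities between such series.
\<close>

typedef 'a mfps = "UNIV :: ((nat \<Rightarrow>\<^sub>0 nat) \<Rightarrow> 'a) set"
  morphisms mfps_nth Abs_mfps
  by simp

lemma mfps_nth_Abs_mfps [simp]: "mfps_nth (Abs_mfps f) e = f e"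
  by (simp add: Abs_mfps_inverse)

lemma mfps_eq_iff: "f = g \<longleftrightarrow> (\<forall>e. mfps_nth f e = mfps_nth g e)"
  by (simp add: mfps_nth_inject [symmetric] fun_eq_iff)

lemma mfps_ext: "(\<And>e. mfps_nth f e = mfps_nth g e) \<Longrightarrow> f = g"
  by (simp add: mfps_eq_iff)

lemma finite_monomial_splits: "finite {(a, b). a + b = (e :: nat \<Rightarrow>\<^sub>0 nat)}"
proof -
  let ?T = "{a :: nat \<Rightarrow>\<^sub>0 nat. \<forall>k. Poly_Mapping.lookup a k \<le> Poly_Mapping.lookup e k}"
  have "Poly_Mapping.lookup ` ?T \<subseteq> {f. (\<forall>k\<in>Poly_Mapping.keys e. f k \<in> {..Max (Poly_Mapping.lookup e ` Poly_Mapping.keys e)}) \<and> (\<forall>k. k \<notin> Poly_Mapping.keys e \<longrightarrow> f k = 0)}"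
  proof clarsimp
    fix a :: "nat \<Rightarrow>\<^sub>0 nat"
    assume le: "\<forall>k. Poly_Mapping.lookup a k \<le> Poly_Mapping.lookup e k"
    show "(\<forall>k\<in>Poly_Mapping.keys e. Poly_Mapping.lookup a k \<le> Max (Poly_Mapping.lookup e ` Poly_Mapping.keys e)) \<and> (\<forall>k. k \<notin> Poly_Mapping.keys e \<longrightarrow> Poly_Mapping.lookup a k = 0)"
    proof (intro conjI ballI allI impI)
      fix k assume "k \<in> Poly_Mapping.keys e"
      then have "Poly_Mapping.lookup e k \<le> Max (Poly_Mapping.lookup e ` Poly_Mapping.keys e)"
        by (intro Max_ge) auto
      with le show "Poly_Mapping.lookup a k \<le> Max (Poly_Mapping.lookup e ` Poly_Mapping.keys e)"
        using order_trans by blast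
    next
      fix k assume "k \<notin> Poly_Mapping.keys e"
      then have "Poly_Mapping.lookup e k = 0" by (simp add: in_keys_iff)
      with le show "Poly_Mapping.lookup a k = 0" by (metis le_zero_eq)
    qed
  qed
  moreover have "finite {f. (\<forall>k\<in>Poly_Mapping.keys e. f k \<in> {..Max (Poly_Mapping.lookup e ` Poly_Mapping.keys e)}) \<and> (\<forall>k. k \<notin> Poly_Mapping.keys e \<longrightarrow> f k = 0)}"
proof -
    have "finite {f. \<forall>k. (k \<in> Poly_Mapping.keys e \<longrightarrow> f k \<in> {..Max (Poly_Mapping.lookup e ` Poly_Mapping.keys e)}) \<and>
                          (k \<notin> Poly_Mapping.keys e \<longrightarrow> f k = 0)}"
      by (rule finite_set_of_finite_funs) simp_all
    then show ?thesis
      by (rule rev_finite_subset) auto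
  qed
  ultimately have "finite (Poly_Mapping.lookup ` ?T)"
    by (rule finite_subset)
  then have fin: "finite ?T"
    by (rule finite_imageD) (auto intro!: inj_onI poly_mapping_eqI)
  have "{(a, b). a + b = e} \<subseteq> ?T \<times> ?T"
    by (auto simp: lookup_add)
  then show ?thesis
    using fin by (meson finite_SigmaI finite_subset)
qed

instantiation mfps :: (comm_ring_1) comm_ring_1
begin

definition zero_mfps :: "'a mfps"
  where "0 = Abs_mfps (\<lambda>e. 0)"

definition one_mfps :: "'a mfps"
  where "1 = Abs_mfps (\<lambda>e. if e = 0 then 1 else 0)"

definition plus_mfps :: "'a mfps \<Rightarrow> 'a mfps \<Rightarrow> 'a mfps"
  where "f + g = Abs_mfps (\<lambda>e. mfps_nth f e + mfps_nth g e)"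

definition uminus_mfps :: "'a mfps \<Rightarrow> 'a mfps"
  where "- f = Abs_mfps (\<lambda>e. - mfps_nth f e)"

definition minus_mfps :: "'a mfps \<Rightarrow> 'a mfps \<Rightarrow> 'a mfps"
  where "f - g = Abs_mfps (\<lambda>e. mfps_nth f e - mfps_nth g e)"

definition times_mfps :: "'a mfps \<Rightarrow> 'a mfps \<Rightarrow> 'a mfps"
  where "f * g = Abs_mfps (\<lambda>e. \<Sum>(a, b) \<in> {(a, b). a + b = e}. mfps_nth f a * mfps_nth g b)"

instance
proof
  fix f g h :: "'a mfps"
  note defs = zero_mfps_def one_mfps_def plus_mfps_def uminus_mfps_def minus_mfps_def times_mfps_def
  show "f + g + h = f + (g + h)" "f + g = g + f" "0 + f = f" "- f + f = 0" "f - g = f + - g"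
    by (simp_all add: defs mfps_eq_iff algebra_simps)
  show "(0 :: 'a mfps) \<noteq> 1"
    by (auto simp: defs mfps_eq_iff)
  show "(f + g) * h = f * h + g * h"
    by (simp add: defs mfps_eq_iff algebra_simps sum.distrib case_prod_unfold)
  show comm: "f * g = g * f" for f g :: "'a mfps"
  proof (rule mfps_ext)
    fix e
    show "mfps_nth (f * g) e = mfps_nth (g * f) e"
      unfolding times_mfps_def mfps_nth_Abs_mfps
      by (rule sum.reindex_bij_witness[of _ prod.swap prod.swap]) (auto simp: ac_simps)
  qed
  show "1 * f = f"
  proof (rule mfps_ext)
    fix e
    have "mfps_nth (1 * f) e
        = (\<Sum>p \<in> {(a, b). a + b = e}. if (0, e) = p then mfps_nth f e else 0)"
      unfolding times_mfps_def one_mfps_def mfps_nth_Abs_mfps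
      by (rule sum.cong) (auto split: if_splits)
    also have "\<dots> = mfps_nth f e"
      by (subst sum.delta') (auto simp: finite_monomial_splits)
    finally show "mfps_nth (1 * f) e = mfps_nth f e" .
  qed
  show "f * g * h = f * (g * h)"
  proof (rule mfps_ext)
    fix e :: "nat \<Rightarrow>\<^sub>0 nat"
    let ?D = "\<lambda>e :: nat \<Rightarrow>\<^sub>0 nat. {(a, b). a + b = e}"
    have "mfps_nth (f * g * h) e
        = (\<Sum>p \<in> ?D e. \<Sum>r \<in> ?D (fst p). mfps_nth f (fst r) * mfps_nth g (snd r) * mfps_nth h (snd p))"
      by (simp add: times_mfps_def case_prod_unfold sum_distrib_right)
    also have "\<dots> = (\<Sum>(p, r) \<in> Sigma (?D e) (\<lambda>p. ?D (fst p)).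
                      mfps_nth f (fst r) * mfps_nth g (snd r) * mfps_nth h (snd p))"
      by (rule sum.Sigma) (use finite_monomial_splits in auto)
    also have "\<dots> = (\<Sum>(p, r) \<in> Sigma (?D e) (\<lambda>p. ?D (snd p)).
                      mfps_nth f (fst p) * (mfps_nth g (fst r) * mfps_nth h (snd r)))"
      by (rule sum.reindex_bij_witness[of _
            "\<lambda>(p, r). ((fst p + fst r, snd r), (fst p, fst r))"
            "\<lambda>(p, r). ((fst r, snd r + snd p), (snd r, snd p))"])
         (auto simp: ac_simps)
    also have "\<dots> = (\<Sum>p \<in> ?D e. \<Sum>r \<in> ?D (snd p). mfps_nth f (fst p) * (mfps_nth g (fst r) * mfps_nth h (snd r)))"
      by (rule sum.Sigma [symmetric]) (use finite_monomial_splits in auto)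
    also have "\<dots> = mfps_nth (f * (g * h)) e"
      by (simp add: times_mfps_def case_prod_unfold sum_distrib_left)
    finally show "mfps_nth (f * g * h) e = mfps_nth (f * (g * h)) e" .
  qed
qed

end

definition mfps_scale :: "'a::comm_ring_1 \<Rightarrow> 'a mfps \<Rightarrow> 'a mfps"  (infixr \<open>\<cdot>\<^sub>c\<close> 75)
  where "c \<cdot>\<^sub>c f = Abs_mfps (\<lambda>e. c * mfps_nth f e)"


section \<open>Monomial and fundamental quasisymmetric functions\<close>

definition comp_of :: "nat \<Rightarrow> nat set \<Rightarrow> nat list"
  where "comp_of n I =
    (if n = 0 then []
     else let s = sorted_list_of_set I in map2 (\<lambda>a b. a - b) (s @ [n]) (0 # s))"

text \<open>
  \<open>M_fun \<alpha>\<close> is the formal sum of the monomials \<open>x\<^bsub>i\<^sub>1\<^esub>\<^bsup>\<alpha>\<^sub>1\<^esup> \<cdots> x\<^bsub>i\<^sub>l\<^esub>\<^bsup>\<alpha>\<^sub>l\<^esup>\<close> over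
  all \<open>i\<^sub>1 < \<cdots> < i\<^sub>l\<close>: the coefficient at \<open>e\<close> counts the index sequences that produce the
  exponent vector \<open>e\<close>. If all parts of \<open>\<alpha>\<close> are positive there is at most one.
\<close>

definition M_fun :: "nat list \<Rightarrow> 'a::comm_ring_1 mfps"
  where "M_fun \<alpha> = Abs_mfps (\<lambda>e. of_nat (card
    {is :: nat list. length is = length \<alpha> \<and> sorted_wrt (<) is \<and>
       (\<Sum>j<length \<alpha>. Poly_Mapping.single (is ! j) (\<alpha> ! j)) = e}))"

text \<open>The set \<open>[n - 1]\<close> is written \<open>{1..<n}\<close>; it is empty for \<open>n = 0\<close> and \<open>n = 1\<close>.\<close>

definition L_fun :: "nat \<Rightarrow> nat set \<Rightarrow> 'a::comm_ring_1 mfps"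
  where "L_fun n I = (\<Sum>J | I \<subseteq> J \<and> J \<subseteq> {1..<n}. M_fun (comp_of n J))"


section \<open>Hivert's quasisymmetric Hall--Littlewood functions\<close>

type_synonym Cq = "complex poly fract"

definition q :: Cq
  where "q = Fract [:0, 1:] 1"

definition wt :: "nat set \<Rightarrow> nat \<Rightarrow> nat"
  where "wt I i = card ({1..i - 1} \<inter> I) + 1"

definition s_stat :: "nat set \<Rightarrow> nat set \<Rightarrow> nat"
  where "s_stat I J = (\<Sum>i \<in> J - I. wt I i)"

definition G_fun :: "nat \<Rightarrow> nat set \<Rightarrow> Cq mfps"
  where "G_fun n I =
    (\<Sum>J | I \<subseteq> J \<and> J \<subseteq> {1..<n}. ((- 1) ^ card (J - I) * q ^ s_stat I J) \<cdot>\<^sub>c L_fun n J)"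


section \<open>Words\<close>

text \<open>
  Words are lists, and their positions are counted from \<open>1\<close>: the letter \<open>w(i)\<close> is \<open>letter w i\<close>.
  A permutation of \<open>[n]\<close> is an element of \<^term>\<open>permutations_of_set {1..n}\<close>, and the shifted
  shuffle of \<open>u\<close> and \<open>v\<close> is \<^term>\<open>shuffles u (shift m v)\<close>.
\<close>

abbreviation letter :: "nat list \<Rightarrow> nat \<Rightarrow> nat"
  where "letter w i \<equiv> w ! (i - 1)"

definition Des :: "nat list \<Rightarrow> nat set"
  where "Des w = {i \<in> {1..<length w}. letter w i > letter w (i + 1)}"

definition shift :: "nat \<Rightarrow> nat list \<Rightarrow> nat list"
  where "shift m v = map (\<lambda>a. a + m) v"

definition low :: "nat \<Rightarrow> nat list \<Rightarrow> nat list"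
  where "low m w = filter (\<lambda>a. a \<le> m) w"

definition high :: "nat \<Rightarrow> nat list \<Rightarrow> nat list"
  where "high m w = filter (\<lambda>a. a > m) w"

definition low0 :: "nat \<Rightarrow> nat list \<Rightarrow> nat list"
  where "low0 m w = map (\<lambda>a. if a > m then 0 else a) w"

definition high0 :: "nat \<Rightarrow> nat list \<Rightarrow> nat list"
  where "high0 m w = map (\<lambda>a. if a \<le> m then 0 else a) w"

definition nonzero_pos :: "nat list \<Rightarrow> nat set"
  where "nonzero_pos x = {i \<in> {1..length x}. letter x i \<noteq> 0}"

definition std_map :: "nat set \<Rightarrow> nat \<Rightarrow> nat"
  where "std_map P i = card {j \<in> P. j \<le> i}"

text \<open>\<open>std_map P\<close> is the order-preserving bijection from \<open>P\<close> onto \<open>[|P|]\<close>.\<close>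

lemma std_map_strict_mono:
  assumes "finite P"
  shows "strict_mono_on P (std_map P)"
proof (rule strict_mono_onI)
  fix i j assume ij: "i \<in> P" "j \<in> P" "i < j"
  have "{k \<in> P. k \<le> i} \<subseteq> {k \<in> P. k \<le> j}" "j \<in> {k \<in> P. k \<le> j}" "j \<notin> {k \<in> P. k \<le> i}"
    using ij by auto
  then have "{k \<in> P. k \<le> i} \<subset> {k \<in> P. k \<le> j}"
    by blast
  then show "std_map P i < std_map P j"
    unfolding std_map_def using assms by (intro psubset_card_mono) auto
qed

lemma std_map_bij_betw:
  assumes "finite P"
  shows "bij_betw (std_map P) P {1..card P}"
proof -
  have inj: "inj_on (std_map P) P"
    using std_map_strict_mono[OF assms] by (rule strict_mono_on_imp_inj_on)
  have sub: "std_map P ` P \<subseteq> {1..card P}"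
  proof (clarsimp simp: std_map_def)
    fix i assume "i \<in> P"
    then have "{j \<in> P. j \<le> i} \<noteq> {}" by auto
    then have "card {j \<in> P. j \<le> i} > 0"
      using assms by (simp add: card_gt_0_iff)
    moreover have "card {j \<in> P. j \<le> i} \<le> card P"
      by (rule card_mono) (use assms in auto)
    ultimately show "Suc 0 \<le> card {j \<in> P. j \<le> i} \<and> card {j \<in> P. j \<le> i} \<le> card P"
      by simp
  qed
  have "std_map P ` P = {1..card P}"
    by (rule card_subset_eq[OF _ sub]) (simp_all add: card_image inj)
  with inj show ?thesis
    by (simp add: bij_betw_def)
qed

definition sDes :: "nat list \<Rightarrow> nat set"
  where "sDes x = std_map (nonzero_pos x) ` Des x - {card (nonzero_pos x)}"

text \<open>Position of the letter \<open>a\<close> in the word \<open>x\<close>, in which it is assumed to occur exactly once.\<close>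

definition position :: "nat list \<Rightarrow> nat \<Rightarrow> nat"
  where "position x a = (THE i. i \<in> {1..length x} \<and> letter x i = a)"

definition pos :: "nat list \<Rightarrow> nat \<Rightarrow> nat \<Rightarrow> nat"
  where "pos w m i =
    (if letter w i \<le> m then position (low m w) (letter w i)
     else position (high m w) (letter w i))"

definition sw :: "nat \<Rightarrow> nat list \<Rightarrow> nat \<Rightarrow> Cq"
  where "sw m w i =
    (if letter w i \<le> m \<and> letter w (i + 1) \<le> m then q ^ wt (Des (low m w)) (pos w m i)
     else if letter w i > m \<and> letter w (i + 1) > m then q ^ wt (Des (high m w)) (pos w m i)
     else 0)"

text \<open>\<open>I\<close> and \<open>J\<close> are the descent sets of the two words whose shifted shuffle contains \<open>w\<close>.\<close>

definition c_coeff :: "nat \<Rightarrow> nat set \<Rightarrow> nat set \<Rightarrow> nat list \<Rightarrow> Cq"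
  where "c_coeff m I J w =
    (\<Prod>i \<in> sDes (low0 m w) - I. 1 - q ^ wt I i) *
    (\<Prod>i \<in> sDes (high0 m w) - J. 1 - q ^ wt J i)"

end

theory Submission
  imports Defs
begin

text \<open>
  A monomial of degree \<open>n\<close> is the same as a weakly increasing sequence of \<open>n\<close> variables, or as a way to
  cut a word of length \<open>n\<close> into consecutive blocks, the \<open>k\<close>-th block having the exponent of the \<open>k\<close>-th
  variable as its length. The function \<open>L\<^sub>I\<close> collects the monomials whose block ends include \<open>I\<close>.
  Summing over the sets between \<open>I\<close> and the set of all block ends, one sees that the coefficient of such a
  monomial in \<open>G\<^sub>I\<close> is the product of \<open>1 - q ^ wt I i\<close> over the block ends \<open>i < n\<close> outside \<open>I\<close>. If \<open>I\<close>
  is the descent set of the word, the monomials that occur are those with sorted blocks, and each block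
  contributes a factor which depends only on its last letter (lemma \<open>mfps_nth_G_fun\<close>).

  On the right-hand side the inner sum over \<open>K\<close> telescopes: expanding each \<open>G\<^sub>K\<close> into fundamental
  functions, the powers \<open>q ^ wt K i\<close> cancel, and what remains is the sum over \<open>J \<supseteq> Des w\<close> of \<open>L\<^sub>J\<close>
  weighted by the product of \<open>- sw m w i\<close> over \<open>i \<in> J - Des w\<close> (lemma \<open>sum_G_fun_eq_weighted_L\<close>). Its
  coefficients have the same shape as before, with \<open>1 - sw m w i\<close> for \<open>1 - q ^ wt I i\<close>.

  It remains to compare weighted block decompositions of the two words with those of their shuffles. A
  sorted block of a shuffle consists of small letters followed by large letters, so cutting it there is
  a bijection onto pairs of block decompositions of the two words (lemma \<open>sum_pairs_of_blocks\<close>). It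
  preserves the weights. The left-hand side has a factor for the last small and the last large letter of
  every block. If the next letter \<open>w(i + 1)\<close> of the shuffle is on the other side, this factor belongs to
  \<open>c_coeff\<close>, which is the product over all changes of sides. If it is on the same side, then \<open>i\<close> ends a
  block of the shuffle, and the factor is \<open>1 - sw m w i\<close>, or 1 at a descent. If there is no next
  letter, the factor is 1 (lemma \<open>shuffle_weight_blocks\<close>).
\<close>

section \<open>Coefficient extraction\<close>

lemma mfps_nth_zero [simp]: "mfps_nth 0 e = 0"
  by (simp add: zero_mfps_def)

lemma mfps_nth_add [simp]: "mfps_nth (f + g) e = mfps_nth f e + mfps_nth g e"
  by (simp add: plus_mfps_def)

lemma mfps_nth_sum: "mfps_nth (\<Sum>x\<in>A. f x) e = (\<Sum>x\<in>A. mfps_nth (f x) e)"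
  by (induction A rule: infinite_finite_induct) auto

lemma mfps_nth_scale [simp]: "mfps_nth (c \<cdot>\<^sub>c f) e = c * mfps_nth f e"
  by (simp add: mfps_scale_def)

lemma mfps_nth_times:
  "mfps_nth (f * g) e = (\<Sum>(a, b) \<in> {(a, b). a + b = e}. mfps_nth f a * mfps_nth g b)"
  by (simp add: times_mfps_def)


section \<open>From Hall--Littlewood functions to the fundamental basis\<close>

lemma wt_cong:
  assumes "\<And>j. 1 \<le> j \<Longrightarrow> j < i \<Longrightarrow> j \<in> K \<longleftrightarrow> j \<in> K'"
  shows "wt K i = wt K' i"
proof -
  have "{1..i - 1} \<inter> K = {1..i - 1} \<inter> K'"
    using assms by auto
  then show ?thesis by (simp add: wt_def)
qed

text \<open>
  The weight of a position depends on \<open>K\<close> only below that position. So if \<open>b\<close> is the largest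
  element of \<open>E\<close>, the choices \<open>b \<in> X\<close> and \<open>b \<notin> X\<close> leave all other factors unchanged and
  contribute \<open>(t ^ wt b - f b) + (- t ^ wt b) = - f b\<close>.
\<close>

lemma sum_telescoping_weights:
  fixes t :: "'a::comm_ring_1" and f :: "nat \<Rightarrow> 'a"
  assumes "finite E" "D \<inter> E = {}"
  shows "(\<Sum>X\<in>Pow E. (\<Prod>i\<in>X. t ^ wt (D \<union> X) i - f i) * (\<Prod>i\<in>E - X. - (t ^ wt (D \<union> X) i)))
    = (\<Prod>i\<in>E. - f i)"
  using assms
proof (induction E rule: finite_linorder_max_induct)
  case empty
  then show ?case by simp
next
  case (insert b E)
  let ?a = "\<lambda>X i. t ^ wt (D \<union> X) i"
  have b: "b \<notin> E" "\<And>i. i \<in> E \<Longrightarrow> i < b" and fin: "finite E"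
    using insert by auto
  have wt_insert: "wt (D \<union> insert b X) i = wt (D \<union> X) i" if "i \<le> b" for X i
    by (rule wt_cong) (use that in auto)
  let ?T = "\<lambda>X. (\<Prod>i\<in>X. ?a X i - f i) * (\<Prod>i\<in>E - X. - ?a X i)"
  have out: "(\<Prod>i\<in>X. ?a X i - f i) * (\<Prod>i\<in>insert b E - X. - ?a X i) = - ?a X b * ?T X"
    if "X \<in> Pow E" for X
  proof -
    have "insert b E - X = insert b (E - X)" using that b by auto
    then show ?thesis using that b fin by (simp add: algebra_simps)
  qed
  have inn: "(\<Prod>i\<in>insert b X. ?a (insert b X) i - f i) *
      (\<Prod>i\<in>insert b E - insert b X. - ?a (insert b X) i) = (?a X b - f b) * ?T X"
    if "X \<in> Pow E" for X
  proof -
    have X: "finite X" "b \<notin> X" "insert b E - insert b X = E - X"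
      using that b fin by (auto intro: finite_subset)
    have "(\<Prod>i\<in>X. ?a (insert b X) i - f i) = (\<Prod>i\<in>X. ?a X i - f i)"
      by (rule prod.cong) (use that b in \<open>auto simp only: wt_insert less_imp_le Pow_iff subset_iff\<close>)
    moreover have "(\<Prod>i\<in>E - X. - ?a (insert b X) i) = (\<Prod>i\<in>E - X. - ?a X i)"
      by (rule prod.cong) (use that b in \<open>auto simp only: wt_insert less_imp_le Diff_iff\<close>)
    ultimately show ?thesis
      using X wt_insert[of b X] by (simp add: algebra_simps)
  qed
  have "(\<Sum>X\<in>Pow (insert b E). (\<Prod>i\<in>X. ?a X i - f i) * (\<Prod>i\<in>insert b E - X. - ?a X i))
      = (\<Sum>X\<in>Pow E. - ?a X b * ?T X) + (\<Sum>X\<in>Pow E. (?a X b - f b) * ?T X)"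
  proof -
    have "inj_on (insert b) (Pow E)"
      using b(1) by (auto simp: inj_on_def)
    moreover have "Pow E \<inter> insert b ` Pow E = {}"
      using b(1) by auto
    ultimately have "(\<Sum>X\<in>Pow (insert b E). F X) = (\<Sum>X\<in>Pow E. F X) + (\<Sum>X\<in>Pow E. F (insert b X))"
      for F :: "nat set \<Rightarrow> 'a"
      using fin by (simp add: Pow_insert sum.union_disjoint sum.reindex)
    then show ?thesis
      by (simp only: out inn cong: sum.cong)
  qed
  also have "\<dots> = - f b * (\<Sum>X\<in>Pow E. ?T X)"
    by (simp add: sum.distrib [symmetric] sum_distrib_left algebra_simps)
  also have "\<dots> = (\<Prod>i\<in>insert b E. - f i)"
    using insert b fin by simp
  finally show ?case .
qed

lemma G_fun_eq_weighted_L: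
  "G_fun n I = (\<Sum>J | I \<subseteq> J \<and> J \<subseteq> {1..<n}. (\<Prod>i\<in>J - I. - (q ^ wt I i)) \<cdot>\<^sub>c L_fun n J)"
proof -
  have "(- 1) ^ card A * q ^ (\<Sum>i\<in>A. wt I i) = (\<Prod>i\<in>A. - (q ^ wt I i))" for A
  proof -
    have "(\<Prod>i\<in>A. - (q ^ wt I i)) = (\<Prod>i\<in>A. (- 1) * q ^ wt I i)" by simp
    also have "\<dots> = (\<Prod>i\<in>A. - 1) * (\<Prod>i\<in>A. q ^ wt I i)" by (rule prod.distrib)
    finally show ?thesis by (simp add: power_sum)
  qed
  then show ?thesis by (simp add: G_fun_def s_stat_def)
qed

text \<open>
  This disposes of the inner sum of the theorem. For \<open>f = 0\<close> it expresses \<open>L\<^sub>D\<close> through the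
  functions \<open>G\<^sub>K\<close>, and for \<open>f i = q ^ wt D i\<close> only \<open>K = D\<close> survives on the left.
\<close>

lemma sum_G_fun_eq_weighted_L:
  assumes "D \<subseteq> {1..<n}"
  shows "(\<Sum>K | D \<subseteq> K \<and> K \<subseteq> {1..<n}. (\<Prod>i\<in>K - D. q ^ wt K i - f i) \<cdot>\<^sub>c G_fun n K)
    = (\<Sum>J | D \<subseteq> J \<and> J \<subseteq> {1..<n}. (\<Prod>i\<in>J - D. - f i) \<cdot>\<^sub>c L_fun n J)"
proof (rule mfps_ext)
  fix e
  let ?S = "{K. D \<subseteq> K \<and> K \<subseteq> {1..<n}}"
  let ?l = "\<lambda>J. mfps_nth (L_fun n J) e :: Cq"
  let ?p = "\<lambda>K. \<Prod>i\<in>K - D. q ^ wt K i - f i"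
  let ?r = "\<lambda>K J. \<Prod>i\<in>J - K. - (q ^ wt K i)"
  have fin: "finite ?S"
    by (rule finite_subset[of _ "Pow {1..<n}"]) auto
  have "(\<Sum>K\<in>?S. ?p K * mfps_nth (G_fun n K) e)
      = (\<Sum>K\<in>?S. \<Sum>J\<in>{J\<in>?S. K \<subseteq> J}. ?p K * ?r K J * ?l J)"
  proof (rule sum.cong [OF refl])
    fix K assume "K \<in> ?S"
    then have "{J. K \<subseteq> J \<and> J \<subseteq> {1..<n}} = {J \<in> ?S. K \<subseteq> J}" by auto
    then show "?p K * mfps_nth (G_fun n K) e = (\<Sum>J\<in>{J\<in>?S. K \<subseteq> J}. ?p K * ?r K J * ?l J)"
      by (simp add: G_fun_eq_weighted_L mfps_nth_sum sum_distrib_left mult.assoc)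
  qed
  also have "\<dots> = (\<Sum>J\<in>?S. \<Sum>K\<in>{K\<in>?S. K \<subseteq> J}. ?p K * ?r K J * ?l J)"
    by (rule sum.swap_restrict) (use fin in auto)
  also have "\<dots> = (\<Sum>J\<in>?S. (\<Prod>i\<in>J - D. - f i) * ?l J)"
  proof (rule sum.cong [OF refl])
    fix J assume J: "J \<in> ?S"
    then have finJ: "finite (J - D)" using finite_subset[of J "{1..<n}"] by auto
    have "(\<Sum>K\<in>{K\<in>?S. K \<subseteq> J}. ?p K * ?r K J)
        = (\<Sum>X\<in>Pow (J - D). (\<Prod>i\<in>X. q ^ wt (D \<union> X) i - f i) * (\<Prod>i\<in>J - D - X. - (q ^ wt (D \<union> X) i)))"
    proof (rule sum.reindex_bij_witness[of _ "\<lambda>X. D \<union> X" "\<lambda>K. K - D"])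
      fix K assume K: "K \<in> {K \<in> ?S. K \<subseteq> J}"
      then have "D \<union> (K - D) = K" "J - D - (K - D) = J - K" by auto
      then show "(\<Prod>i\<in>K - D. q ^ wt (D \<union> (K - D)) i - f i) *
          (\<Prod>i\<in>J - D - (K - D). - (q ^ wt (D \<union> (K - D)) i)) = ?p K * ?r K J"
        by simp
    qed (use J in auto)
    also have "\<dots> = (\<Prod>i\<in>J - D. - f i)"
      by (rule sum_telescoping_weights [OF finJ]) auto
    finally show "(\<Sum>K\<in>{K\<in>?S. K \<subseteq> J}. ?p K * ?r K J * ?l J) = (\<Prod>i\<in>J - D. - f i) * ?l J"
      by (simp add: sum_distrib_right [symmetric])
  qed
  finally show "mfps_nth (\<Sum>K | D \<subseteq> K \<and> K \<subseteq> {1..<n}. ?p K \<cdot>\<^sub>c G_fun n K) e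
      = mfps_nth (\<Sum>J | D \<subseteq> J \<and> J \<subseteq> {1..<n}. (\<Prod>i\<in>J - D. - f i) \<cdot>\<^sub>c L_fun n J) e"
    by (simp add: mfps_nth_sum)
qed


section \<open>Partial sums and compositions\<close>

text \<open>
  The positions at which a word can be cut into blocks of lengths \<open>es\<close>. For a composition of \<open>n\<close>
  this is its subset of \<open>[n - 1]\<close> with \<open>0\<close> and \<open>n\<close> added; blocks of length \<open>0\<close> change nothing, so
  that an exponent vector can be used without removing the variables that do not occur.
\<close>

fun psums :: "nat list \<Rightarrow> nat set"
  where
    "psums [] = {0}"
  | "psums (e # es) = insert 0 ((+) e ` psums es)"

lemma zero_in_psums [simp]: "0 \<in> psums es"
  by (cases es) auto

lemma sum_list_in_psums [simp]: "sum_list es \<in> psums es"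
  by (induction es) auto

lemma psums_le: "i \<in> psums es \<Longrightarrow> i \<le> sum_list es"
  by (induction es arbitrary: i) auto

lemma psums_filter: "psums (filter (\<lambda>x. 0 < x) es) = psums es"
  by (induction es) (auto simp: insert_absorb)

lemma psums_inject:
  assumes "\<forall>x\<in>set \<alpha>. 0 < x" "\<forall>x\<in>set \<beta>. 0 < x" "psums \<alpha> = psums \<beta>"
  shows "\<alpha> = \<beta>"
  using assms
proof (induction \<alpha> arbitrary: \<beta>)
  case Nil
  then have "sum_list \<beta> \<in> {0}"
    using sum_list_in_psums[of \<beta>] by (simp only: psums.simps)
  with Nil show ?case by (cases \<beta>) auto
next
  case (Cons e es)
  have "e + 0 \<in> psums \<beta>"
    using Cons.prems(3) by (metis imageI insertI2 psums.simps(2) zero_in_psums)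
  moreover have "e > 0" using Cons.prems by simp
  ultimately obtain f fs where \<beta>: "\<beta> = f # fs"
    by (cases \<beta>) auto
  have f: "f > 0" "\<forall>x\<in>set fs. 0 < x" using Cons.prems \<beta> by auto
  have "f + 0 \<in> psums (e # es)"
    unfolding Cons.prems(3) \<beta> by (simp add: image_iff)
  then have "e \<le> f" using f by auto
  moreover have "f \<le> e" using \<open>e + 0 \<in> psums \<beta>\<close> \<open>e > 0\<close> \<beta> by auto
  ultimately have ef: "e = f" by simp
  have "insert 0 ((+) e ` psums es) = insert 0 ((+) e ` psums fs)"
    using Cons.prems(3) \<beta> ef by simp
  moreover have "0 \<notin> (+) e ` psums es" "0 \<notin> (+) e ` psums fs"
    using \<open>e > 0\<close> by auto
  ultimately have "(+) e ` psums es = (+) e ` psums fs"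
    by (simp add: insert_ident)
  then have "psums es = psums fs"
    by (simp add: inj_image_eq_iff)
  then show ?case using Cons.IH[of fs] Cons.prems f \<beta> ef by simp
qed

lemma psums_differences:
  assumes "sorted_wrt (<) s" "\<forall>x\<in>set s. c < x \<and> x < n" "c < n"
  shows "(+) c ` psums (map2 (\<lambda>a b. a - b) (s @ [n]) (c # s)) = insert c (insert n (set s)) \<and>
    (\<forall>x\<in>set (map2 (\<lambda>a b. a - b) (s @ [n]) (c # s)). 0 < x)"
  using assms
proof (induction s arbitrary: c)
  case Nil
  then show ?case by auto
next
  case (Cons a s)
  let ?d = "map2 (\<lambda>a b. a - b) (s @ [n]) (a # s)"
  have IH: "(+) a ` psums ?d = insert a (insert n (set s)) \<and> (\<forall>x\<in>set ?d. 0 < x)"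
    by (rule Cons.IH) (use Cons.prems in auto)
  have "(+) c ` psums ((a - c) # ?d) = insert c ((\<lambda>x. c + (a - c + x)) ` psums ?d)"
    by (simp add: image_image)
  also have "(\<lambda>x. c + (a - c + x)) = (+) a"
    using Cons.prems by (auto simp: fun_eq_iff)
  finally show ?case using IH Cons.prems by auto
qed

lemma
  assumes "J \<subseteq> {1..<n}"
  shows psums_comp_of: "psums (comp_of n J) = insert 0 (insert n J)"
    and comp_of_pos: "\<forall>x\<in>set (comp_of n J). 0 < x"
proof -
  have "psums (comp_of n J) = insert 0 (insert n J) \<and> (\<forall>x\<in>set (comp_of n J). 0 < x)"
  proof (cases "n = 0")
    case True
    then show ?thesis using assms by (simp add: comp_of_def)
  next
    case False
    have "finite J" using assms finite_subset by blast
    moreover have "\<forall>x\<in>J. 0 < x \<and> x < n" using assms by auto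
    ultimately show ?thesis
      using psums_differences[of "sorted_list_of_set J" 0 n] False
      by (simp add: comp_of_def Let_def image_Collect)
  qed
  then show "psums (comp_of n J) = insert 0 (insert n J)" "\<forall>x\<in>set (comp_of n J). 0 < x"
    by blast+
qed


section \<open>Coefficients of the fundamental quasisymmetric functions\<close>

text \<open>As the parts of \<open>\<alpha>\<close> are positive, the indices are forced to be the variables that occur.\<close>

lemma mfps_nth_M_fun:
  assumes "\<forall>x\<in>set \<alpha>. 0 < x"
  shows "mfps_nth (M_fun \<alpha> :: 'a::comm_ring_1 mfps) e =
    of_bool (\<alpha> = map (Poly_Mapping.lookup e) (sorted_list_of_set (Poly_Mapping.keys e)))"
proof -
  let ?k = "sorted_list_of_set (Poly_Mapping.keys e)"
  define S where "S = {is. length is = length \<alpha> \<and> sorted_wrt (<) is \<and>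
       (\<Sum>j<length \<alpha>. Poly_Mapping.single (is ! j) (\<alpha> ! j)) = e}"
  have forced: "is = ?k \<and> \<alpha> = map (Poly_Mapping.lookup e) ?k" if "is \<in> S" for "is"
  proof -
    have len: "length is = length \<alpha>" and sorted: "sorted_wrt (<) is"
      and e: "e = (\<Sum>j<length \<alpha>. Poly_Mapping.single (is ! j) (\<alpha> ! j))"
      using that by (auto simp: S_def)
    have dist: "distinct is" using sorted by (simp add: strict_sorted_iff)
    have look: "Poly_Mapping.lookup e (is ! i) = \<alpha> ! i" if "i < length \<alpha>" for i
    proof -
      have "Poly_Mapping.lookup e (is ! i) = (\<Sum>j<length \<alpha>. if j = i then \<alpha> ! j else 0)"
        unfolding e lookup_sum
        by (rule sum.cong) (use dist that len in \<open>auto simp: lookup_single when_def nth_eq_iff_index_eq\<close>)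
      then show ?thesis using that by simp
    qed
    have "Poly_Mapping.keys e = set is"
    proof
      show "Poly_Mapping.keys e \<subseteq> set is"
        unfolding e by (rule order_trans[OF keys_sum]) (use len in \<open>auto split: if_splits\<close>)
      show "set is \<subseteq> Poly_Mapping.keys e"
        using look assms len by (fastforce simp: in_set_conv_nth in_keys_iff)
    qed
    then have "?k = is"
      using sorted by (simp add: strict_sorted_iff sorted_list_of_set.idem_if_sorted_distinct)
    moreover have "map (Poly_Mapping.lookup e) is = \<alpha>"
      by (rule nth_equalityI) (use len look in auto)
    ultimately show ?thesis by simp
  qed
  have "?k \<in> S" if "\<alpha> = map (Poly_Mapping.lookup e) ?k"
  proof -
    have "(\<Sum>j<length \<alpha>. Poly_Mapping.single (?k ! j) (\<alpha> ! j))
        = (\<Sum>j<length ?k. Poly_Mapping.single (?k ! j) (Poly_Mapping.lookup e (?k ! j)))"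
    proof (rule sum.cong)
      show "{..<length \<alpha>} = {..<length ?k}" by (subst that) simp
    next
      fix j assume "j \<in> {..<length ?k}"
      then show "Poly_Mapping.single (?k ! j) (\<alpha> ! j)
          = Poly_Mapping.single (?k ! j) (Poly_Mapping.lookup e (?k ! j))"
        by (subst that) simp
    qed
    also have "\<dots> = (\<Sum>k\<leftarrow>?k. Poly_Mapping.single k (Poly_Mapping.lookup e k))"
      by (simp add: sum_list_sum_nth atLeast0LessThan)
    also have "\<dots> = (\<Sum>k\<in>Poly_Mapping.keys e. Poly_Mapping.single k (Poly_Mapping.lookup e k))"
      by (simp add: sum_list_distinct_conv_sum_set)
    also have "\<dots> = e"
      by (rule poly_mapping_eqI)
         (simp add: lookup_sum lookup_single when_def in_keys_iff)
    finally show ?thesis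
      using arg_cong [OF that, of length] by (simp add: S_def)
  qed
  then have "S = (if \<alpha> = map (Poly_Mapping.lookup e) ?k then {?k} else {})"
    using forced by (simp split: if_split) blast
  then have "card S = of_bool (\<alpha> = map (Poly_Mapping.lookup e) ?k)"
    by simp
  then show ?thesis by (simp add: M_fun_def S_def)
qed

definition exponents :: "nat \<Rightarrow> (nat \<Rightarrow>\<^sub>0 nat) \<Rightarrow> nat list"
  where "exponents N e = map (Poly_Mapping.lookup e) [0..<N]"

text \<open>
  A monomial of degree \<open>n\<close> is a weakly increasing sequence of \<open>n\<close> variables. It belongs to exactly one
  monomial quasisymmetric function, namely that of the set of its strict increases.
\<close>

lemma mfps_nth_M_fun_comp_of:
  assumes "J \<subseteq> {1..<n}" "Poly_Mapping.keys e \<subseteq> {..<N}"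
  shows "mfps_nth (M_fun (comp_of n J) :: 'a::comm_ring_1 mfps) e =
    of_bool (sum_list (exponents N e) = n \<and> J = psums (exponents N e) \<inter> {1..<n})"
proof -
  let ?es = "exponents N e"
  let ?\<alpha> = "map (Poly_Mapping.lookup e) (sorted_list_of_set (Poly_Mapping.keys e))"
  have "sorted_list_of_set (Poly_Mapping.keys e) = filter (\<lambda>k. k \<in> Poly_Mapping.keys e) [0..<N]"
  proof (rule sorted_distinct_set_unique)
    show "set (sorted_list_of_set (Poly_Mapping.keys e)) = set (filter (\<lambda>k. k \<in> Poly_Mapping.keys e) [0..<N])"
      using assms by auto
  qed (auto intro: sorted_wrt_filter)
  then have "?\<alpha> = filter (\<lambda>x. 0 < x) ?es"
    by (simp add: exponents_def filter_map o_def in_keys_iff)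
  then have ps: "psums ?\<alpha> = psums ?es" and pos: "\<forall>x\<in>set ?\<alpha>. 0 < x"
    by (simp_all add: psums_filter)
  have "comp_of n J = ?\<alpha> \<longleftrightarrow> insert 0 (insert n J) = psums ?es"
    using psums_inject[OF comp_of_pos[OF assms(1)] pos] ps psums_comp_of[OF assms(1)] by auto
  also have "\<dots> \<longleftrightarrow> sum_list ?es = n \<and> J = psums ?es \<inter> {1..<n}"
  proof
    assume eq: "insert 0 (insert n J) = psums ?es"
    have "sum_list ?es \<in> insert 0 (insert n J)" "n \<in> psums ?es"
      unfolding eq by simp (simp add: eq [symmetric])
    moreover have "x \<le> n" if "x \<in> insert 0 (insert n J)" for x
      using that assms(1) by auto
    ultimately have "sum_list ?es \<le> n" "n \<le> sum_list ?es"
      by (blast, blast intro: psums_le)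
    moreover have "J = insert 0 (insert n J) \<inter> {1..<n}"
      using assms(1) by auto
    ultimately show "sum_list ?es = n \<and> J = psums ?es \<inter> {1..<n}"
      unfolding eq by (rule conjI [OF antisym])
  next
    assume "sum_list ?es = n \<and> J = psums ?es \<inter> {1..<n}"
    then have n: "sum_list ?es = n" and J: "J = psums ?es \<inter> {1..<n}" by blast+
    have "n \<in> psums ?es" using sum_list_in_psums[of ?es] n by metis
    moreover have "i \<le> n" if "i \<in> psums ?es" for i using psums_le [OF that] n by metis
    ultimately show "insert 0 (insert n J) = psums ?es"
      unfolding J by (auto simp: Suc_le_eq order.not_eq_order_implies_strict)
  qed
  finally show ?thesis
    by (simp add: mfps_nth_M_fun [OF comp_of_pos [OF assms(1)]])
qed

lemma mfps_nth_L_fun: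
  assumes "I \<subseteq> {1..<n}" "Poly_Mapping.keys e \<subseteq> {..<N}"
  shows "mfps_nth (L_fun n I :: 'a::comm_ring_1 mfps) e =
    of_bool (sum_list (exponents N e) = n \<and> I \<subseteq> psums (exponents N e))"
proof -
  let ?P = "psums (exponents N e) \<inter> {1..<n}"
  let ?S = "{J. I \<subseteq> J \<and> J \<subseteq> {1..<n}}"
  have fin: "finite ?S"
    by (rule finite_subset[of _ "Pow {1..<n}"]) auto
  have "mfps_nth (L_fun n I :: 'a mfps) e
      = (\<Sum>J\<in>?S. if J = ?P then of_bool (sum_list (exponents N e) = n) else 0)"
    unfolding L_fun_def mfps_nth_sum
    by (rule sum.cong) (use assms(2) in \<open>auto simp: mfps_nth_M_fun_comp_of\<close>)
  then show ?thesis using assms fin by auto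
qed

text \<open>
  A weight \<open>- g i\<close> for each position added to the descent set turns into a factor \<open>1 - g i\<close> for
  each strict increase that is not forced by a descent.
\<close>

lemma mfps_nth_weighted_L:
  fixes g :: "nat \<Rightarrow> 'a::comm_ring_1"
  assumes "D \<subseteq> {1..<n}" "Poly_Mapping.keys e \<subseteq> {..<N}"
  defines "es \<equiv> exponents N e"
  shows "mfps_nth (\<Sum>J | D \<subseteq> J \<and> J \<subseteq> {1..<n}. (\<Prod>i\<in>J - D. - g i) \<cdot>\<^sub>c L_fun n J) e =
    of_bool (sum_list es = n \<and> D \<subseteq> psums es) * (\<Prod>i \<in> psums es \<inter> {1..<n} - D. 1 - g i)"
proof -
  let ?P = "psums es \<inter> {1..<n}"
  let ?S = "{J. D \<subseteq> J \<and> J \<subseteq> {1..<n}}"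
  have fin: "finite ?S"
    by (rule finite_subset[of _ "Pow {1..<n}"]) auto
  have "mfps_nth (\<Sum>J\<in>?S. (\<Prod>i\<in>J - D. - g i) \<cdot>\<^sub>c L_fun n J) e
      = (\<Sum>J\<in>?S. if J \<subseteq> ?P then of_bool (sum_list es = n) * (\<Prod>i\<in>J - D. - g i) else 0)"
    unfolding mfps_nth_sum es_def mfps_nth_scale
    by (rule sum.cong) (use assms(2) in \<open>auto simp: mfps_nth_L_fun\<close>)
  also have "\<dots> = of_bool (sum_list es = n) * (\<Sum>J\<in>{J. D \<subseteq> J \<and> J \<subseteq> ?P}. \<Prod>i\<in>J - D. - g i)"
  proof -
    have *: "?S \<inter> {J. J \<subseteq> ?P} = {J. D \<subseteq> J \<and> J \<subseteq> ?P}" by auto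
    show ?thesis
      unfolding sum.If_cases [OF fin] * by (simp only: sum_distrib_left sum.neutral_const add_0_right)
  qed
  also have "\<dots> = of_bool (sum_list es = n \<and> D \<subseteq> psums es) * (\<Prod>i \<in> ?P - D. 1 - g i)"
  proof (cases "D \<subseteq> ?P")
    case True
    have "(\<Prod>i \<in> ?P - D. - g i + 1) = (\<Sum>X\<in>Pow (?P - D). \<Prod>i\<in>X. - g i)"
      by (subst prod_add) auto
    also have "\<dots> = (\<Sum>J\<in>{J. D \<subseteq> J \<and> J \<subseteq> ?P}. \<Prod>i\<in>J - D. - g i)"
      by (rule sum.reindex_bij_witness[of _ "\<lambda>J. J - D" "\<lambda>X. D \<union> X"])
         (use True in \<open>auto intro!: arg_cong[where f = "prod _"]\<close>)
    finally show ?thesis using True by auto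
  next
    case False
    then have "{J. D \<subseteq> J \<and> J \<subseteq> ?P} = {}" "\<not> D \<subseteq> psums es" using assms(1) by auto
    then show ?thesis by (simp only: sum.empty) simp
  qed
  finally show ?thesis .
qed


section \<open>Adjacent letters and block decompositions\<close>

text \<open>
  Descents, and the places where a shuffle changes sides, are both conditions on two neighbouring
  letters, and this is all that their behaviour under concatenation depends on.
\<close>

definition adjacent :: "(nat \<Rightarrow> nat \<Rightarrow> bool) \<Rightarrow> nat list \<Rightarrow> nat set"
  where "adjacent R w = {i \<in> {1..<length w}. R (letter w i) (letter w (i + 1))}"

definition switches :: "nat \<Rightarrow> nat list \<Rightarrow> nat set"
  where "switches m = adjacent (\<lambda>a b. (a \<le> m) \<noteq> (b \<le> m))"

lemma Des_eq_adjacent: "Des w = adjacent (\<lambda>a b. a > b) w"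
  by (simp add: Des_def adjacent_def)

lemma adjacent_subset: "adjacent R w \<subseteq> {1..<length w}"
  by (auto simp: adjacent_def)

lemma finite_adjacent [simp]: "finite (adjacent R w)"
  by (rule finite_subset [OF adjacent_subset]) simp

lemma switches_subset: "switches m w \<subseteq> {1..<length w}"
  unfolding switches_def by (rule adjacent_subset)

lemma finite_switches [simp]: "finite (switches m w)"
  by (simp add: switches_def)

lemma Des_subset: "Des w \<subseteq> {1..<length w}"
  by (auto simp: Des_def)

lemma letter_append:
  "1 \<le> i \<Longrightarrow> i \<le> length x \<Longrightarrow> letter (x @ y) i = letter x i"
  "1 \<le> i \<Longrightarrow> letter (x @ y) (length x + i) = letter y i"
  by (auto simp: nth_append)

text \<open>
  The seam will always be the end of a block. Adding it on both sides avoids a case distinction on the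
  two letters around it.
\<close>

lemma insert_length_adjacent_append:
  "insert (length x) (adjacent R (x @ y)) =
    insert (length x) (adjacent R x \<union> (+) (length x) ` adjacent R y)" (is "?L = ?R")
proof (rule set_eqI)
  fix i
  consider "i < length x" | "i = length x" | j where "i = length x + j" "1 \<le> j"
    by (metis Suc_leI add.commute less_imp_add_positive linorder_neqE_nat One_nat_def)
  then show "i \<in> ?L \<longleftrightarrow> i \<in> ?R"
  proof cases
    case 1
    then show ?thesis by (auto simp: adjacent_def nth_append)
  next
    case 3
    then have "length x + j - Suc 0 = length x + (j - Suc 0)" by simp
    with 3 show ?thesis by (auto simp: adjacent_def nth_append)
  qed simp
qed

lemmas insert_length_switches_append =
  insert_length_adjacent_append [of _ "\<lambda>a b. (a \<le> m) \<noteq> (b \<le> m)" for m, folded switches_def]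

lemma Des_empty_iff_sorted: "Des w = {} \<longleftrightarrow> sorted w"
proof -
  have "Des w = {} \<longleftrightarrow> (\<forall>i. Suc i < length w \<longrightarrow> w ! i \<le> w ! Suc i)"
  proof safe
    fix i assume "Des w = {}" "Suc i < length w"
    then have "Suc i \<notin> Des w" by simp
    with \<open>Suc i < length w\<close> show "w ! i \<le> w ! Suc i" by (simp add: Des_def)
  next
    fix i assume *: "\<forall>i. Suc i < length w \<longrightarrow> w ! i \<le> w ! Suc i" and "i \<in> Des w"
    then show "i \<in> {}" using *[rule_format, of "i - 1"] by (auto simp: Des_def)
  qed
  then show ?thesis by (simp add: sorted_iff_nth_Suc)
qed

text \<open>A descent of the concatenation lies inside a block or at the end of one, and the latter is allowed.\<close>

lemma Des_concat_subset_psums_iff: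
  "Des (concat Bs) \<subseteq> psums (map length Bs) \<longleftrightarrow> (\<forall>B\<in>set Bs. sorted B)"
proof (induction Bs)
  case Nil
  then show ?case by (simp add: Des_def)
next
  case (Cons B Bs)
  let ?l = "length B" and ?w = "concat Bs" and ?P = "psums (map length Bs)"
  have P: "?l \<in> insert 0 ((+) ?l ` ?P)"
    using image_eqI[of ?l "(+) ?l" 0 ?P] by simp
  have "Des (B @ ?w) \<subseteq> insert 0 ((+) ?l ` ?P)
      \<longleftrightarrow> insert ?l (Des (B @ ?w)) \<subseteq> insert 0 ((+) ?l ` ?P)"
    using P by blast
  also have "\<dots> \<longleftrightarrow> Des B \<subseteq> insert 0 ((+) ?l ` ?P) \<and> (+) ?l ` Des ?w \<subseteq> insert 0 ((+) ?l ` ?P)"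
    unfolding Des_eq_adjacent insert_length_adjacent_append using P by blast
  also have "Des B \<subseteq> insert 0 ((+) ?l ` ?P) \<longleftrightarrow> Des B = {}"
    using Des_subset[of B] by fastforce
  also have "(+) ?l ` Des ?w \<subseteq> insert 0 ((+) ?l ` ?P) \<longleftrightarrow> Des ?w \<subseteq> ?P"
    using Des_subset[of ?w] by auto
  finally show ?case using Cons.IH by (simp add: Des_empty_iff_sorted)
qed

definition increasing_blocks :: "nat list \<Rightarrow> nat list \<Rightarrow> nat list list set"
  where "increasing_blocks es w =
    {Bs. concat Bs = w \<and> map length Bs = es \<and> (\<forall>B\<in>set Bs. sorted B)}"

lemma ex_blocks:
  "sum_list es = length w \<Longrightarrow> \<exists>Bs. concat Bs = w \<and> map length Bs = es"
proof (induction es arbitrary: w)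
  case (Cons e es)
  then have "sum_list es = length (drop e w)" by simp
  then obtain Bs where "concat Bs = drop e w" "map length Bs = es"
    using Cons.IH by blast
  then show ?case
    using Cons.prems by (intro exI[of _ "take e w # Bs"]) auto
qed simp

lemma blocks_unique:
  assumes "concat Bs = concat Cs" "map length Bs = map length Cs"
  shows "Bs = Cs"
  using assms
proof (induction Bs arbitrary: Cs)
  case (Cons B Bs)
  then obtain C Cs' where "Cs = C # Cs'" by (cases Cs) auto
  with Cons show ?case by auto
qed simp

text \<open>
  A word has at most one decomposition into blocks of prescribed lengths, and its blocks are sorted
  iff every descent ends a block. This turns the support condition of a coefficient into a sum over
  block decompositions, which can then be reindexed together with the sums around it.
\<close>

lemma sum_increasing_blocks:
  fixes F :: "'a::comm_ring_1"
  shows "(\<Sum>Bs\<in>increasing_blocks es w. F) =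
    of_bool (sum_list es = length w \<and> Des w \<subseteq> psums es) * F"
proof (cases "sum_list es = length w")
  case True
  then obtain Bs where Bs: "concat Bs = w" "map length Bs = es"
    using ex_blocks by blast
  then have "increasing_blocks es w = {Cs \<in> {Bs}. \<forall>B\<in>set Cs. sorted B}"
    unfolding increasing_blocks_def using blocks_unique by blast
  moreover have "Des w \<subseteq> psums es \<longleftrightarrow> (\<forall>B\<in>set Bs. sorted B)"
    using Des_concat_subset_psums_iff[of Bs] Bs by simp
  ultimately have "increasing_blocks es w = (if Des w \<subseteq> psums es then {Bs} else {})"
    by auto
  then show ?thesis using True by simp
next
  case False
  have "Bs \<notin> increasing_blocks es w" for Bs
    using False by (auto simp: increasing_blocks_def length_concat)
  then have "increasing_blocks es w = {}" by blast
  then show ?thesis using False by simp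
qed

lemma finite_increasing_blocks [simp]: "finite (increasing_blocks es w)"
proof -
  have "finite {Bs. concat Bs = w \<and> map length Bs = es}"
  proof (cases "{Bs. concat Bs = w \<and> map length Bs = es} = {}")
    case False
    then obtain Bs where "concat Bs = w" "map length Bs = es" by blast
    then have "{Bs. concat Bs = w \<and> map length Bs = es} = {Bs}"
      using blocks_unique by blast
    then show ?thesis by simp
  next
    case True
    show ?thesis unfolding True by (rule finite.emptyI)
  qed
  then show ?thesis
    by (rule rev_finite_subset) (auto simp: increasing_blocks_def)
qed


section \<open>Products over the ends of blocks\<close>

definition last_factor :: "(nat \<Rightarrow> 'a::comm_ring_1) \<Rightarrow> nat list \<Rightarrow> 'a"
  where "last_factor \<psi> B = (if B = [] then 1 else \<psi> (last B))"

lemma sorted_low_high: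
  assumes "sorted B"
  shows "low m B @ high m B = B"
  using assms
proof (induction B)
  case (Cons a B)
  show ?case
  proof (cases "a \<le> m")
    case True
    with Cons show ?thesis by (simp add: low_def high_def)
  next
    case False
    with Cons.prems have "\<forall>b\<in>set (a # B). b > m" by auto
    then show ?thesis by (auto simp: low_def high_def filter_empty_conv)
  qed
qed (simp add: low_def high_def)

lemma switches_empty:
  assumes "(\<forall>a\<in>set w. a \<le> m) \<or> (\<forall>a\<in>set w. m < a)"
  shows "switches m w = {}"
proof -
  have "False" if "i \<in> switches m w" for i
  proof -
    have i: "i - 1 < length w" "i < length w" and neq: "(w ! (i - 1) \<le> m) \<noteq> (w ! i \<le> m)"
      using that unfolding switches_def adjacent_def by auto
    from assms show False
      using nth_mem[OF i(1)] nth_mem[OF i(2)] neq not_le by blast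
  qed
  then show ?thesis by blast
qed

lemma prod_ends_sorted:
  assumes "sorted B" "B \<noteq> []"
  shows "(\<Prod>i\<in>insert (length B) (switches m B). \<psi> (letter B i)) =
    last_factor \<psi> (low m B) * last_factor \<psi> (high m B)"
proof -
  define L H where "L = low m B" and "H = high m B"
  have B: "B = L @ H" using sorted_low_high[OF assms(1), of m] by (simp add: L_def H_def)
  have LH: "\<forall>a\<in>set L. a \<le> m" "\<forall>a\<in>set H. m < a" by (auto simp: L_def H_def low_def high_def)
  have sw: "insert (length L) (switches m B) = {length L}"
    unfolding B insert_length_switches_append using LH by (simp add: switches_empty)
  consider "L = []" "H \<noteq> []" | "L \<noteq> []" "H = []" | "L \<noteq> []" "H \<noteq> []"
    using assms B by auto
  then show ?thesis unfolding L_def [symmetric] H_def [symmetric]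
  proof cases
    case 1
    then have "switches m B = {}" using LH B by (simp add: switches_empty)
    then show "(\<Prod>i\<in>insert (length B) (switches m B). \<psi> (letter B i)) = last_factor \<psi> L * last_factor \<psi> H"
      using 1 B by (simp add: last_factor_def last_conv_nth)
  next
    case 2
    then have "switches m B = {}" using LH B by (simp add: switches_empty)
    then show "(\<Prod>i\<in>insert (length B) (switches m B). \<psi> (letter B i)) = last_factor \<psi> L * last_factor \<psi> H"
      using 2 B by (simp add: last_factor_def last_conv_nth)
  next
    case 3
    have "length L \<in> switches m B"
    proof -
      have "letter B (length L) = last L" "letter B (length L + 1) = hd H"
        using 3 B by (auto simp: nth_append last_conv_nth hd_conv_nth)
      moreover have "last L \<le> m" "m < hd H" using LH 3 by auto
      ultimately show ?thesis using 3 B by (auto simp: switches_def adjacent_def Suc_le_eq)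
    qed
    then have "switches m B = {length L}" using sw by blast
    moreover have "letter B (length L) = last L" "letter B (length B) = last H"
      using 3 B last_conv_nth[of L] last_conv_nth[of B] by (auto simp: nth_append)
    ultimately show "(\<Prod>i\<in>insert (length B) (switches m B). \<psi> (letter B i)) = last_factor \<psi> L * last_factor \<psi> H"
      using 3 B by (simp add: last_factor_def mult.commute)
  qed
qed

text \<open>
  In a sorted block the small letters precede the large ones. So the positions that end a block or
  precede a change of sides carry exactly the last small and the last large letter of each block.
\<close>

lemma prod_ends_concat:
  assumes "\<forall>B\<in>set Bs. sorted B"
  shows "(\<Prod>i \<in> (psums (map length Bs) - {0}) \<union> switches m (concat Bs). \<psi> (letter (concat Bs) i)) =
    (\<Prod>B\<leftarrow>Bs. last_factor \<psi> (low m B) * last_factor \<psi> (high m B))"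
  using assms
proof (induction Bs)
  case Nil
  then show ?case by (simp add: switches_def adjacent_def)
next
  case (Cons B Bs)
  let ?w = "concat Bs" and ?l = "length B" and ?P = "psums (map length Bs)"
  have IH: "(\<Prod>i \<in> (?P - {0}) \<union> switches m ?w. \<psi> (letter ?w i)) =
    (\<Prod>B\<leftarrow>Bs. last_factor \<psi> (low m B) * last_factor \<psi> (high m B))"
    using Cons by simp
  show ?case
  proof (cases "B = []")
    case True
    then show ?thesis using IH
      by (simp add: last_factor_def low_def high_def insert_absorb)
  next
    case False
    let ?Y = "insert ?l (switches m B)" and ?X = "(?P - {0}) \<union> switches m ?w"
    have Y: "?Y \<subseteq> {1..?l}" using False switches_subset[of m B] by (auto simp: Suc_le_eq)
    have "finite ?P"
      by (rule finite_subset[of _ "{..sum_list (map length Bs)}"]) (use psums_le in auto)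
    then have X: "finite ?X" "?X \<subseteq> {1..}"
      using switches_subset[of m ?w] by auto
    have "(psums (map length (B # Bs)) - {0}) = insert ?l ((+) ?l ` (?P - {0}))"
      using False by (auto simp: image_iff)
    then have "(psums (map length (B # Bs)) - {0}) \<union> switches m (concat (B # Bs))
        = (+) ?l ` (?P - {0}) \<union> insert ?l (switches m (B @ ?w))"
      by simp
    also have "\<dots> = ?Y \<union> (+) ?l ` ?X"
      unfolding insert_length_switches_append by auto
    finally have split: "(psums (map length (B # Bs)) - {0}) \<union> switches m (concat (B # Bs))
        = ?Y \<union> (+) ?l ` ?X" .
    have "(\<Prod>i \<in> ?Y \<union> (+) ?l ` ?X. \<psi> (letter (B @ ?w) i))
        = (\<Prod>i\<in>?Y. \<psi> (letter (B @ ?w) i)) * (\<Prod>i\<in>(+) ?l ` ?X. \<psi> (letter (B @ ?w) i))"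
    proof (rule prod.union_disjoint)
      show "?Y \<inter> (+) ?l ` ?X = {}" using Y X(2) by force
    qed (use X in auto)
    also have "(\<Prod>i\<in>?Y. \<psi> (letter (B @ ?w) i)) = (\<Prod>i\<in>?Y. \<psi> (letter B i))"
    proof (rule prod.cong [OF refl])
      fix i assume "i \<in> ?Y"
      then have "1 \<le> i" "i \<le> ?l" using Y by auto
      then show "\<psi> (letter (B @ ?w) i) = \<psi> (letter B i)" by (simp only: letter_append)
    qed
    also have "\<dots> = last_factor \<psi> (low m B) * last_factor \<psi> (high m B)"
      by (rule prod_ends_sorted) (use Cons.prems False in auto)
    also have "(\<Prod>i\<in>(+) ?l ` ?X. \<psi> (letter (B @ ?w) i)) = (\<Prod>i\<in>?X. \<psi> (letter (B @ ?w) (?l + i)))"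
      by (subst prod.reindex) auto
    also have "\<dots> = (\<Prod>i\<in>?X. \<psi> (letter ?w i))"
    proof (rule prod.cong [OF refl])
      fix i assume "i \<in> ?X"
      then have "1 \<le> i" using X(2) by auto
      then show "\<psi> (letter (B @ ?w) (?l + i)) = \<psi> (letter ?w i)" by (simp only: letter_append)
    qed
    finally show ?thesis using IH split by simp
  qed
qed

lemma prod_ends_one_sided:
  assumes "\<forall>B\<in>set Bs. sorted B"
  shows "(\<Prod>i \<in> psums (map length Bs) - {0}. \<psi> (letter (concat Bs) i)) =
    (\<Prod>B\<leftarrow>Bs. last_factor \<psi> B)"
proof -
  obtain m where m: "\<forall>a\<in>set (concat Bs). a \<le> m"
    using finite_nat_set_iff_bounded_le by blast
  then have "switches m (concat Bs) = {}" by (simp add: switches_empty)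
  moreover have "map (\<lambda>B. last_factor \<psi> (low m B) * last_factor \<psi> (high m B)) Bs = map (last_factor \<psi>) Bs"
  proof (rule map_cong [OF refl])
    fix B assume "B \<in> set Bs"
    then have "\<forall>a\<in>set B. a \<le> m" using m by auto
    then have "low m B = B" "high m B = []"
      by (auto simp: low_def high_def filter_empty_conv not_less)
    then show "last_factor \<psi> (low m B) * last_factor \<psi> (high m B) = last_factor \<psi> B"
      by (simp add: last_factor_def)
  qed
  ultimately show ?thesis
    using prod_ends_concat[OF assms, where m = m and \<psi> = \<psi>] by (simp only: Un_empty_right)
qed


section \<open>Coefficients of the Hall--Littlewood functions\<close>

lemma position_letter:
  assumes "distinct x" "i \<in> {1..length x}"
  shows "position x (letter x i) = i"
  unfolding position_def
proof (rule the_equality)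
  fix j assume "j \<in> {1..length x} \<and> letter x j = letter x i"
  then have "j - 1 = i - 1" using assms nth_eq_iff_index_eq[OF assms(1), of "j - 1" "i - 1"] by auto
  then show "j = i" using assms \<open>j \<in> {1..length x} \<and> _\<close> by auto
qed (use assms in simp)

text \<open>
  The weight of a letter instead of a position: it refers to the letter's own word \<open>x\<close> and keeps
  its meaning when \<open>x\<close> is shuffled with another word. Descents and the last letter get weight 1.
\<close>

definition ascent_factor :: "nat list \<Rightarrow> nat \<Rightarrow> Cq"
  where "ascent_factor x a =
    (if position x a \<in> {1..<length x} - Des x then 1 - q ^ wt (Des x) (position x a) else 1)"

text \<open>
  By the choice of the factors, the product over the strict increases outside \<open>Des x\<close> may be extended
  to the ends of all blocks.
\<close>

lemma mfps_nth_G_fun: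
  assumes "distinct x" "Poly_Mapping.keys e \<subseteq> {..<N}"
  shows "mfps_nth (G_fun (length x) (Des x)) e =
    (\<Sum>Us\<in>increasing_blocks (exponents N e) x. \<Prod>U\<leftarrow>Us. last_factor (ascent_factor x) U)"
proof -
  let ?es = "exponents N e" and ?n = "length x"
  let ?F = "\<Prod>i \<in> psums ?es \<inter> {1..<?n} - Des x. 1 - q ^ wt (Des x) i"
  have "mfps_nth (G_fun ?n (Des x)) e
      = of_bool (sum_list ?es = ?n \<and> Des x \<subseteq> psums ?es) * ?F"
    unfolding G_fun_eq_weighted_L by (rule mfps_nth_weighted_L [OF Des_subset assms(2)])
  also have "\<dots> = (\<Sum>Us\<in>increasing_blocks ?es x. ?F)"
    by (rule sum_increasing_blocks [symmetric])
  also have "\<dots> = (\<Sum>Us\<in>increasing_blocks ?es x. \<Prod>U\<leftarrow>Us. last_factor (ascent_factor x) U)"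
  proof (rule sum.cong [OF refl])
    fix Us assume Us: "Us \<in> increasing_blocks ?es x"
    have x: "concat Us = x" and es: "map length Us = ?es" and sorted: "\<forall>U\<in>set Us. sorted U"
      using Us by (auto simp: increasing_blocks_def)
    have "sum_list ?es = ?n" unfolding es [symmetric] x [symmetric] by (simp add: length_concat)
    then have P: "psums ?es \<subseteq> {0..?n}" using psums_le by fastforce
    then have "finite (psums ?es)" using finite_subset by blast
    then have "?F = (\<Prod>i \<in> psums ?es - {0}. ascent_factor x (letter x i))"
    proof (intro prod.mono_neutral_cong_left ballI)
      fix i assume i: "i \<in> psums ?es - {0} - (psums ?es \<inter> {1..<?n} - Des x)"
      then have "position x (letter x i) = i"
        using P by (intro position_letter [OF assms(1)]) auto
      then show "ascent_factor x (letter x i) = 1" using i by (auto simp: ascent_factor_def)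
    next
      fix i assume i: "i \<in> psums ?es \<inter> {1..<?n} - Des x"
      then have "position x (letter x i) = i"
        by (intro position_letter [OF assms(1)]) auto
      then show "1 - q ^ wt (Des x) i = ascent_factor x (letter x i)"
        using i by (simp add: ascent_factor_def)
    qed auto
    then show "?F = (\<Prod>U\<leftarrow>Us. last_factor (ascent_factor x) U)"
      using prod_ends_one_sided[OF sorted, of "ascent_factor x"] x es by simp
  qed
  finally show ?thesis .
qed


section \<open>The weights of a shuffle\<close>

lemma letter_filter:
  fixes Q :: "nat \<Rightarrow> bool"
  assumes "i \<in> {1..length w}" "Q (letter w i)"
  defines "j \<equiv> length (filter Q (take i w))"
  shows "j \<in> {1..length (filter Q w)}" and "letter (filter Q w) j = letter w i"
proof -
  obtain k where k: "i = Suc k" "k < length w" using assms(1) by (cases i) auto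
  have w: "w = take k w @ w ! k # drop (Suc k) w" and t: "take (Suc k) w = take k w @ [w ! k]"
    using k by (auto simp: id_take_nth_drop take_Suc_conv_app_nth)
  have "filter Q w = filter Q (take k w) @ w ! k # filter Q (drop (Suc k) w)"
    by (subst (1) w) (use assms(2) k in simp)
  moreover have "j = Suc (length (filter Q (take k w)))"
    using assms(2) k unfolding j_def k(1) t by simp
  ultimately show "j \<in> {1..length (filter Q w)}" "letter (filter Q w) j = letter w i"
    using k by (simp_all add: nth_append)
qed

lemma position_filter:
  assumes "distinct w" "i \<in> {1..length w}" "Q (letter w i)"
  shows "position (filter Q w) (letter w i) = length (filter Q (take i w))"
proof -
  have "position (filter Q w) (letter (filter Q w) (length (filter Q (take i w))))
      = length (filter Q (take i w))"
    by (rule position_letter) (use assms letter_filter[of i w Q] in auto)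
  then show ?thesis using letter_filter(2)[of i w Q] assms by simp
qed

lemma ascent_factor_last:
  assumes "distinct w" "w \<noteq> []" "Q (letter w (length w))"
  shows "ascent_factor (filter Q w) (letter w (length w)) = 1"
  using position_filter[of w "length w" Q] assms
  by (simp add: ascent_factor_def Suc_le_eq)

text \<open>Neighbours in \<open>w\<close> from the same side are neighbours in their own word.\<close>

lemma adjacent_same_side:
  assumes "distinct w" "i \<in> {1..<length w}" "Q (letter w i)" "Q (letter w (i + 1))"
  defines "x \<equiv> filter Q w"
  shows "position x (letter w i) \<in> {1..<length x}"
    and "position x (letter w i) \<in> Des x \<longleftrightarrow> i \<in> Des w"
proof -
  let ?j = "length (filter Q (take i w))"
  have i: "i < length w" "1 \<le> i" using assms(2) by auto
  have j: "?j \<in> {1..length x}" "letter x ?j = letter w i"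
    unfolding x_def using letter_filter[of i w Q] assms by auto
  have "length (filter Q (take (i + 1) w)) = ?j + 1"
    using assms(4) i by (simp add: take_Suc_conv_app_nth)
  then have j1: "?j + 1 \<in> {1..length x}" "letter x (?j + 1) = letter w (i + 1)"
    unfolding x_def using letter_filter[of "i + 1" w Q] assms by auto
  have p: "position x (letter w i) = ?j"
    unfolding x_def using assms by (intro position_filter) auto
  show "position x (letter w i) \<in> {1..<length x}" using p j j1 by auto
  then show "position x (letter w i) \<in> Des x \<longleftrightarrow> i \<in> Des w"
    unfolding p Des_def using j(2) j1(2) i by simp
qed

lemma ascent_factor_same_side:
  assumes "distinct w" "i \<in> {1..<length w}" "Q (letter w i)" "Q (letter w (i + 1))"
  defines "x \<equiv> filter Q w"
  shows "ascent_factor x (letter w i) =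
    (if i \<in> Des w then 1 else 1 - q ^ wt (Des x) (position x (letter w i)))"
  using adjacent_same_side[OF assms(1-4)] by (simp add: ascent_factor_def x_def)

text \<open>
  The word \<open>z\<close> has a descent wherever \<open>w\<close> leaves the side \<open>Q\<close>, and at the descents of \<open>w\<close> inside
  that side. The latter are descents of \<open>x\<close>, and so drop out of the product on the left.
\<close>

lemma prod_sDes:
  fixes Q :: "nat \<Rightarrow> bool"
  assumes "distinct w" "0 \<notin> set w"
  defines "x \<equiv> filter Q w" and "z \<equiv> map (\<lambda>a. if Q a then a else 0) w"
  shows "(\<Prod>i \<in> sDes z - Des x. 1 - q ^ wt (Des x) i) =
    (\<Prod>i | i \<in> {1..<length w} \<and> Q (letter w i) \<and> \<not> Q (letter w (i + 1)). ascent_factor x (letter w i))"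
proof -
  let ?T = "{i. i \<in> {1..<length w} \<and> Q (letter w i) \<and> \<not> Q (letter w (i + 1))}"
  let ?P = "nonzero_pos z"
  have nz: "w ! i \<noteq> 0" if "i < length w" for i
    using assms(2) nth_mem[OF that] by metis
  have P: "?P = {i \<in> {1..length w}. Q (letter w i)}"
    unfolding nonzero_pos_def z_def using nz by (auto split: if_splits)
  have finP: "finite ?P" unfolding P by simp
  have std: "std_map ?P i = position x (letter w i)" if "i \<in> ?P" for i
  proof -
    have i: "i \<in> {1..length w}" "Q (letter w i)" using that P by auto
    have "{j \<in> ?P. j \<le> i} = Suc ` {k. k < i \<and> Q (w ! k)}"
    proof (rule set_eqI)
      fix j show "j \<in> {j \<in> ?P. j \<le> i} \<longleftrightarrow> j \<in> Suc ` {k. k < i \<and> Q (w ! k)}"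
        unfolding P using i by (cases j) auto
    qed
    then have "std_map ?P i = card {k. k < i \<and> Q (w ! k)}"
      unfolding std_map_def by (simp add: card_image)
    also have "{k. k < i \<and> Q (w ! k)} = {k. k < length (take i w) \<and> Q (take i w ! k)}"
      using i by auto
    also have "card \<dots> = length (filter Q (take i w))"
      by (rule length_filter_conv_card [symmetric])
    also have "\<dots> = position x (letter w i)"
      unfolding x_def using position_filter[of w i Q] assms(1) i by simp
    finally show ?thesis .
  qed
  have card: "card ?P = length x"
  proof -
    have "?P = Suc ` {k. k < length w \<and> Q (w ! k)}"
    proof (rule set_eqI)
      fix j show "j \<in> ?P \<longleftrightarrow> j \<in> Suc ` {k. k < length w \<and> Q (w ! k)}"
        unfolding P by (cases j) auto
    qed
    then show ?thesis by (simp add: x_def card_image length_filter_conv_card)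
  qed
  have inj: "inj_on (std_map ?P) ?P" and ran: "std_map ?P ` ?P = {1..length x}"
    using std_map_bij_betw[OF finP] card by (auto simp: bij_betw_def)
  have TP: "?T \<subseteq> ?P" unfolding P by auto
  have Des_z: "Des z = ?T \<union> {i \<in> Des w. Q (letter w i) \<and> Q (letter w (i + 1))}"
  proof (rule set_eqI)
    fix i
    show "i \<in> Des z \<longleftrightarrow> i \<in> ?T \<union> {i \<in> Des w. Q (letter w i) \<and> Q (letter w (i + 1))}"
    proof (cases "i \<in> {1..<length w}")
      case True
      then have "i - Suc 0 < length w" "i < length w" by auto
      then show ?thesis using True nz[of "i - Suc 0"] by (auto simp: Des_def z_def)
    qed (auto simp: Des_def z_def)
  qed
  have inner: "std_map ?P i \<in> Des x" if "i \<in> Des w" "Q (letter w i)" "Q (letter w (i + 1))" for i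
  proof -
    have i: "i \<in> {1..<length w}" using that Des_subset by blast
    then have "i \<in> ?P" unfolding P using that by auto
    then show ?thesis
      using adjacent_same_side(2)[OF assms(1) i, of Q] that std by (simp add: x_def)
  qed
  have "sDes z - Des x = std_map ?P ` ?T - {length x} - Des x"
    unfolding sDes_def card Des_z using inner by auto
  then have "(\<Prod>i \<in> sDes z - Des x. 1 - q ^ wt (Des x) i)
      = (\<Prod>i \<in> std_map ?P ` ?T - {length x} - Des x. 1 - q ^ wt (Des x) i)"
    by simp
  also have "\<dots> = (\<Prod>i \<in> std_map ?P ` ?T.
      if i \<in> {1..<length x} - Des x then 1 - q ^ wt (Des x) i else 1)"
  proof (rule prod.mono_neutral_cong_left)
    fix i assume i: "i \<in> std_map ?P ` ?T - {length x} - Des x"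
    then have "i \<in> {1..length x}" using ran TP by blast
    then show "1 - q ^ wt (Des x) i = (if i \<in> {1..<length x} - Des x then 1 - q ^ wt (Des x) i else 1)"
      using i by auto
  qed auto
  also have "\<dots> = (\<Prod>i\<in>?T. if std_map ?P i \<in> {1..<length x} - Des x then 1 - q ^ wt (Des x) (std_map ?P i) else 1)"
    using inj TP by (subst prod.reindex) (auto intro: inj_on_subset)
  also have "\<dots> = (\<Prod>i\<in>?T. ascent_factor x (letter w i))"
  proof (rule prod.cong [OF refl])
    fix i assume "i \<in> ?T"
    then have "i \<in> ?P" using TP by blast
    then show "(if std_map ?P i \<in> {1..<length x} - Des x then 1 - q ^ wt (Des x) (std_map ?P i) else 1)
        = ascent_factor x (letter w i)"
      by (simp only: std ascent_factor_def)
  qed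
  finally show ?thesis .
qed

text \<open>Each letter of a shuffle keeps the weight it has in its own word.\<close>

definition shuffle_factor :: "nat \<Rightarrow> nat list \<Rightarrow> nat \<Rightarrow> Cq"
  where "shuffle_factor m w a = ascent_factor (if a \<le> m then low m w else high m w) a"

lemma c_coeff_eq_prod_switches:
  assumes "distinct w" "0 \<notin> set w"
  shows "c_coeff m (Des (low m w)) (Des (high m w)) w =
    (\<Prod>i\<in>switches m w. shuffle_factor m w (letter w i))"
proof -
  let ?A = "{i. i \<in> {1..<length w} \<and> letter w i \<le> m \<and> \<not> letter w (i + 1) \<le> m}"
  let ?B = "{i. i \<in> {1..<length w} \<and> letter w i > m \<and> \<not> letter w (i + 1) > m}"
  have low0: "low0 m w = map (\<lambda>a. if a \<le> m then a else 0) w"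
    and high0: "high0 m w = map (\<lambda>a. if a > m then a else 0) w"
    by (auto simp: low0_def high0_def)
  have "(\<Prod>i \<in> sDes (low0 m w) - Des (low m w). 1 - q ^ wt (Des (low m w)) i)
      = (\<Prod>i\<in>?A. ascent_factor (low m w) (letter w i))"
    unfolding low0 low_def by (rule prod_sDes [OF assms])
  also have "\<dots> = (\<Prod>i\<in>?A. shuffle_factor m w (letter w i))"
    by (rule prod.cong) (auto simp: shuffle_factor_def)
  finally have A: "(\<Prod>i \<in> sDes (low0 m w) - Des (low m w). 1 - q ^ wt (Des (low m w)) i)
      = (\<Prod>i\<in>?A. shuffle_factor m w (letter w i))" .
  have "(\<Prod>i \<in> sDes (high0 m w) - Des (high m w). 1 - q ^ wt (Des (high m w)) i)
      = (\<Prod>i\<in>?B. ascent_factor (high m w) (letter w i))"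
    unfolding high0 high_def by (rule prod_sDes [OF assms])
  also have "\<dots> = (\<Prod>i\<in>?B. shuffle_factor m w (letter w i))"
    by (rule prod.cong) (auto simp: shuffle_factor_def)
  finally have B: "(\<Prod>i \<in> sDes (high0 m w) - Des (high m w). 1 - q ^ wt (Des (high m w)) i)
      = (\<Prod>i\<in>?B. shuffle_factor m w (letter w i))" .
  have "switches m w = ?A \<union> ?B" unfolding switches_def adjacent_def by auto
  moreover have "(\<Prod>i\<in>?A \<union> ?B. shuffle_factor m w (letter w i))
      = (\<Prod>i\<in>?A. shuffle_factor m w (letter w i)) * (\<Prod>i\<in>?B. shuffle_factor m w (letter w i))"
    by (rule prod.union_disjoint) auto
  ultimately show ?thesis unfolding c_coeff_def A B by simp
qed

lemma one_minus_sw: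
  assumes "distinct w" "i \<in> {1..<length w} - Des w - switches m w"
  shows "1 - sw m w i = shuffle_factor m w (letter w i)"
proof (cases "letter w i \<le> m")
  case True
  with assms have "letter w (i + 1) \<le> m" by (auto simp: switches_def adjacent_def)
  then show ?thesis
    using True assms ascent_factor_same_side[OF assms(1), of i "\<lambda>a. a \<le> m"]
    by (simp add: sw_def pos_def shuffle_factor_def low_def)
next
  case False
  with assms have "m < letter w (i + 1)" by (auto simp: switches_def adjacent_def)
  then show ?thesis
    using False assms ascent_factor_same_side[OF assms(1), of i "\<lambda>a. a > m"]
    by (simp add: sw_def pos_def shuffle_factor_def high_def)
qed

lemma sw_switches: "i \<in> switches m w \<Longrightarrow> sw m w i = 0"
  by (auto simp: sw_def switches_def adjacent_def)

text \<open>
  Descents of \<open>w\<close> and the end of \<open>w\<close> always end a block. As the factor is 1 there, away from changes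
  of sides, products may run over the ends of all blocks.
\<close>

lemma shuffle_factor_neutral:
  assumes "distinct w" "i \<in> insert (length w) (Des w) - switches m w" "1 \<le> i"
  shows "shuffle_factor m w (letter w i) = 1"
proof (cases "i = length w")
  case True
  then have "w \<noteq> []" using assms(3) by auto
  then show ?thesis
    using True ascent_factor_last[OF assms(1), of "\<lambda>a. a \<le> m"] ascent_factor_last[OF assms(1), of "\<lambda>a. a > m"]
    by (auto simp: shuffle_factor_def low_def high_def)
next
  case False
  then have D: "i \<in> Des w" and i: "i \<in> {1..<length w}" "(letter w i \<le> m) = (letter w (i + 1) \<le> m)"
    using assms(2) Des_subset[of w] by (auto simp: switches_def adjacent_def)
  show ?thesis
    using ascent_factor_same_side[OF assms(1) i(1), of "\<lambda>a. a \<le> m"]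
      ascent_factor_same_side[OF assms(1) i(1), of "\<lambda>a. a > m"] i(2) D
    by (auto simp: shuffle_factor_def low_def high_def)
qed

text \<open>
  The factor \<open>1 - sw\<close> is 1 where \<open>w\<close> changes sides, and \<open>c_coeff\<close> supplies the missing factor at
  exactly these places, whether or not a block ends there.
\<close>

lemma shuffle_weight_blocks:
  assumes "distinct w" "0 \<notin> set w" "Bs \<in> increasing_blocks es w"
  shows "c_coeff m (Des (low m w)) (Des (high m w)) w *
      (\<Prod>i \<in> psums es \<inter> {1..<length w} - Des w. 1 - sw m w i) =
    (\<Prod>B\<leftarrow>Bs. last_factor (shuffle_factor m w) (low m B) * last_factor (shuffle_factor m w) (high m B))"
proof -
  let ?\<psi> = "\<lambda>i. shuffle_factor m w (letter w i)" and ?S = "switches m w"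
  let ?P = "psums es - {0}"
  have w: "concat Bs = w" and es: "map length Bs = es" and sorted: "\<forall>B\<in>set Bs. sorted B"
    using assms(3) by (auto simp: increasing_blocks_def)
  have "sum_list es = length w" unfolding es [symmetric] w [symmetric] by (simp add: length_concat)
  then have P: "?P \<subseteq> {1..length w}" using psums_le[of _ es] by (auto simp: Suc_le_eq)
  then have finP: "finite ?P" using finite_subset by blast
  have "(\<Prod>i \<in> psums es \<inter> {1..<length w} - Des w. 1 - sw m w i)
      = (\<Prod>i \<in> psums es \<inter> {1..<length w} - Des w - ?S. 1 - sw m w i)"
    by (rule prod.mono_neutral_right) (auto simp: sw_switches)
  also have "\<dots> = (\<Prod>i \<in> ?P - ?S. ?\<psi> i)"
  proof (rule prod.mono_neutral_cong_left)
    show "finite (?P - ?S)" using finP by simp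
    show "\<forall>i\<in>?P - ?S - (psums es \<inter> {1..<length w} - Des w - ?S). ?\<psi> i = 1"
    proof
      fix i assume i: "i \<in> ?P - ?S - (psums es \<inter> {1..<length w} - Des w - ?S)"
      then have "1 \<le> i" "i \<le> length w" using P by auto
      with i show "?\<psi> i = 1"
        by (intro shuffle_factor_neutral [OF assms(1)]) auto
    qed
  qed (auto simp: one_minus_sw [OF assms(1)])
  finally have "c_coeff m (Des (low m w)) (Des (high m w)) w *
      (\<Prod>i \<in> psums es \<inter> {1..<length w} - Des w. 1 - sw m w i) = (\<Prod>i\<in>?S. ?\<psi> i) * (\<Prod>i \<in> ?P - ?S. ?\<psi> i)"
    by (simp only: c_coeff_eq_prod_switches [OF assms(1,2)])
  also have "\<dots> = (\<Prod>i \<in> ?S \<union> (?P - ?S). ?\<psi> i)"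
    by (rule prod.union_disjoint [symmetric]) (use finP in auto)
  also have "?S \<union> (?P - ?S) = ?P \<union> ?S" by blast
  finally show ?thesis
    using prod_ends_concat[OF sorted, where m = m and \<psi> = "shuffle_factor m w"] by (simp only: w es)
qed


section \<open>Shuffling blocks\<close>

lemma prod_list_map_mult:
  fixes f g :: "'b \<Rightarrow> 'a::comm_monoid_mult"
  shows "(\<Prod>x\<leftarrow>xs. f x * g x) = (\<Prod>x\<leftarrow>xs. f x) * (\<Prod>x\<leftarrow>xs. g x)"
  by (induction xs) (auto simp: ac_simps)

lemma shuffles_low_high:
  assumes "\<forall>a\<in>set u. a \<le> m" "\<forall>a\<in>set v. m < a"
  shows "w \<in> shuffles u v \<longleftrightarrow> low m w = u \<and> high m w = v"
proof
  assume w: "w \<in> shuffles u v"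
  have "low m ` shuffles u v = shuffles (low m u) (low m v)"
    "high m ` shuffles u v = shuffles (high m u) (high m v)"
    using filter_shuffles[of "\<lambda>a. a \<le> m" u v] filter_shuffles[of "\<lambda>a. a > m" u v]
    by (simp_all add: low_def high_def)
  moreover have "low m u = u" "low m v = []" "high m u = []" "high m v = v"
    using assms by (auto simp: low_def high_def filter_id_conv filter_empty_conv)
  ultimately show "low m w = u \<and> high m w = v" using w by auto
next
  assume "low m w = u \<and> high m w = v"
  then show "w \<in> shuffles u v"
    using partition_in_shuffles[of w "\<lambda>a. a \<le> m"] by (simp add: low_def high_def not_le)
qed

lemma
  assumes "length Us = length Vs" "\<forall>a\<in>set (concat Us). a \<le> m" "\<forall>a\<in>set (concat Vs). m < a"
  shows map_low_append: "map (low m) (map2 (@) Us Vs) = Us"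
    and map_high_append: "map (high m) (map2 (@) Us Vs) = Vs"
proof -
  have "map (low m) (map2 (@) Us Vs) = Us \<and> map (high m) (map2 (@) Us Vs) = Vs"
    using assms
    by (induction Us Vs rule: list_induct2)
       (auto simp: low_def high_def filter_id_conv filter_empty_conv not_less not_le)
  then show "map (low m) (map2 (@) Us Vs) = Us" "map (high m) (map2 (@) Us Vs) = Vs"
    by blast+
qed

lemma low_concat: "low m (concat Bs) = concat (map (low m) Bs)"
  and high_concat: "high m (concat Bs) = concat (map (high m) Bs)"
  unfolding low_def [abs_def] high_def [abs_def] by (simp_all only: filter_concat)

lemma length_exponents [simp]: "length (exponents N e) = N"
  by (simp add: exponents_def)

lemma exponents_add: "exponents N (a + b) = map2 (+) (exponents N a) (exponents N b)"
  by (rule nth_equalityI) (auto simp: exponents_def lookup_add)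

lemma exponents_inject:
  assumes "Poly_Mapping.keys a \<subseteq> {..<N}" "Poly_Mapping.keys b \<subseteq> {..<N}" "exponents N a = exponents N b"
  shows "a = b"
proof (rule poly_mapping_eqI)
  fix k
  show "Poly_Mapping.lookup a k = Poly_Mapping.lookup b k"
  proof (cases "k < N")
    case True
    then show ?thesis using arg_cong[OF assms(3), of "\<lambda>l. l ! k"] by (simp add: exponents_def)
  next
    case False
    then have "k \<notin> Poly_Mapping.keys a" "k \<notin> Poly_Mapping.keys b" using assms by auto
    then show ?thesis by (simp add: in_keys_iff)
  qed
qed

lemma keys_nth: "Poly_Mapping.keys (Poly_Mapping.nth xs) \<subseteq> {..<length xs}"
  for xs :: "nat list"
proof
  fix k assume "k \<in> Poly_Mapping.keys (Poly_Mapping.nth xs)"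
  then show "k \<in> {..<length xs}"
    unfolding in_keys_iff Poly_Mapping.nth.rep_eq by (auto simp: nth_default_def split: if_splits)
qed

lemma exponents_nth: "exponents (length xs) (Poly_Mapping.nth xs) = xs"
  by (rule nth_equalityI) (auto simp: exponents_def Poly_Mapping.nth.rep_eq nth_default_def)

lemma keys_summand:
  assumes "a + b = (e :: nat \<Rightarrow>\<^sub>0 nat)"
  shows "Poly_Mapping.keys a \<subseteq> Poly_Mapping.keys e" "Poly_Mapping.keys b \<subseteq> Poly_Mapping.keys e"
  using assms by (auto simp: in_keys_iff lookup_add)

text \<open>
  A block of a shuffle is a sorted word, so it is determined by its small and its large letters.
  Thus the sorted block decompositions of the shuffles of \<open>u\<close> and \<open>v\<close> are the pairs of sorted
  block decompositions of \<open>u\<close> and of \<open>v\<close>, concatenated block by block.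
\<close>

lemma sum_pairs_of_blocks:
  fixes F :: "nat list list \<Rightarrow> nat list list \<Rightarrow> 'a::comm_ring_1"
  assumes u: "\<forall>a\<in>set u. a \<le> m" and v: "\<forall>a\<in>set v. m < a"
    and e: "Poly_Mapping.keys e \<subseteq> {..<N}"
  shows "(\<Sum>(a, b) | a + b = e. \<Sum>Us\<in>increasing_blocks (exponents N a) u.
      \<Sum>Vs\<in>increasing_blocks (exponents N b) v. F Us Vs) =
    (\<Sum>w\<in>shuffles u v. \<Sum>Bs\<in>increasing_blocks (exponents N e) w. F (map (low m) Bs) (map (high m) Bs))"
proof -
  let ?I = "\<lambda>e. increasing_blocks (exponents N e)"
  let ?E = "\<lambda>Us :: nat list list. Poly_Mapping.nth (map length Us)"
  let ?L = "Sigma {(a, b). a + b = e} (\<lambda>(a, b). ?I a u \<times> ?I b v)"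
  let ?R = "Sigma (shuffles u v) (?I e)"
  have "(\<Sum>(a, b) | a + b = e. \<Sum>Us\<in>?I a u. \<Sum>Vs\<in>?I b v. F Us Vs)
      = (\<Sum>(p, Us, Vs)\<in>?L. F Us Vs)"
    by (subst sum.Sigma [symmetric])
       (auto simp: finite_monomial_splits sum.cartesian_product intro!: sum.cong)
  also have "\<dots> = (\<Sum>(w, Bs)\<in>?R. F (map (low m) Bs) (map (high m) Bs))"
  proof (rule sum.reindex_bij_witness[of _
        "\<lambda>(w, Bs). ((?E (map (low m) Bs), ?E (map (high m) Bs)), (map (low m) Bs, map (high m) Bs))"
        "\<lambda>(p, Us, Vs). (concat (map2 (@) Us Vs), map2 (@) Us Vs)"])
    fix x assume "x \<in> ?L"
    then obtain a b Us Vs where x: "x = ((a, b), Us, Vs)" and ab: "a + b = e"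
      and Us: "Us \<in> ?I a u" and Vs: "Vs \<in> ?I b v"
      by auto
    have cu: "concat Us = u" and cv: "concat Vs = v"
      and lu: "map length Us = exponents N a" and lv: "map length Vs = exponents N b"
      and su: "\<forall>U\<in>set Us. sorted U" and sv: "\<forall>V\<in>set Vs. sorted V"
      using Us Vs by (auto simp: increasing_blocks_def)
    have NU: "length Us = N" "length Vs = N"
      using arg_cong[OF lu, of length] arg_cong[OF lv, of length] by simp_all
    \<comment> \<open>The exponent vectors \<open>a\<close> and \<open>b\<close> are recovered from the lengths of the blocks.\<close>
    define Bs where "Bs = map2 (@) Us Vs"
    have low: "map (low m) Bs = Us" and high: "map (high m) Bs = Vs"
      unfolding Bs_def using map_low_append map_high_append NU u v cu cv by auto
    have "?E Us = a"
    proof (rule exponents_inject[of _ N])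
      show "Poly_Mapping.keys (?E Us) \<subseteq> {..<N}"
        using keys_nth[of "map length Us"] NU by simp
      show "Poly_Mapping.keys a \<subseteq> {..<N}"
        using keys_summand[OF ab] e by blast
      show "exponents N (?E Us) = exponents N a"
        using exponents_nth[of "map length Us"] NU lu by simp
    qed
    moreover have "?E Vs = b"
    proof (rule exponents_inject[of _ N])
      show "Poly_Mapping.keys (?E Vs) \<subseteq> {..<N}"
        using keys_nth[of "map length Vs"] NU by simp
      show "Poly_Mapping.keys b \<subseteq> {..<N}"
        using keys_summand[OF ab] e by blast
      show "exponents N (?E Vs) = exponents N b"
        using exponents_nth[of "map length Vs"] NU lv by simp
    qed
    ultimately show "(\<lambda>(w, Bs). ((?E (map (low m) Bs), ?E (map (high m) Bs)), (map (low m) Bs, map (high m) Bs)))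
        ((\<lambda>(p, Us, Vs). (concat (map2 (@) Us Vs), map2 (@) Us Vs)) x) = x"
      unfolding x Bs_def [symmetric] prod.case low high by simp
    show "(case (\<lambda>(p, Us, Vs). (concat (map2 (@) Us Vs), map2 (@) Us Vs)) x of
        (w, Bs) \<Rightarrow> F (map (low m) Bs) (map (high m) Bs)) = (case x of (p, Us, Vs) \<Rightarrow> F Us Vs)"
      unfolding x Bs_def [symmetric] prod.case low high by simp
    have "concat Bs \<in> shuffles u v"
      unfolding shuffles_low_high[OF u v] low_concat high_concat low high cu cv by simp
    moreover have "Bs \<in> ?I e (concat Bs)"
    proof -
      have "map length Bs = map2 (+) (map length Us) (map length Vs)"
        unfolding Bs_def by (rule nth_equalityI) auto
      moreover have "sorted B" if "B \<in> set Bs" for B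
      proof -
        obtain i where i: "i < N" "B = Us ! i @ Vs ! i"
          using \<open>B \<in> set Bs\<close> NU unfolding Bs_def by (auto simp: in_set_conv_nth)
        then have mem: "Us ! i \<in> set Us" "Vs ! i \<in> set Vs" using NU by auto
        then have "\<forall>a\<in>set (Us ! i). a \<le> m" "\<forall>a\<in>set (Vs ! i). m < a"
          using u v unfolding cu [symmetric] cv [symmetric] by auto
        then show ?thesis
          using su sv mem i by (fastforce simp: sorted_append)
      qed
      ultimately show ?thesis
        unfolding increasing_blocks_def ab [symmetric] exponents_add lu lv by simp
    qed
    ultimately show "(\<lambda>(p, Us, Vs). (concat (map2 (@) Us Vs), map2 (@) Us Vs)) x \<in> ?R"
      unfolding x Bs_def [symmetric] prod.case by simp
  next
    fix y assume "y \<in> ?R"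
    then obtain w Bs where y: "y = (w, Bs)" and w: "w \<in> shuffles u v" and Bs: "Bs \<in> ?I e w"
      by auto
    have c: "concat Bs = w" and l: "map length Bs = exponents N e" and s: "\<forall>B\<in>set Bs. sorted B"
      using Bs by (auto simp: increasing_blocks_def)
    have NB: "length Bs = N" using arg_cong[OF l, of length] by simp
    define Us Vs where "Us = map (low m) Bs" and "Vs = map (high m) Bs"
    have "map2 (@) Us Vs = map (\<lambda>B. low m B @ high m B) Bs"
      unfolding Us_def Vs_def by (induction Bs) auto
    also have "\<dots> = Bs" using s by (simp add: sorted_low_high map_idI)
    finally have join: "map2 (@) Us Vs = Bs" .
    show "(\<lambda>(p, Us, Vs). (concat (map2 (@) Us Vs), map2 (@) Us Vs))
        ((\<lambda>(w, Bs). ((?E (map (low m) Bs), ?E (map (high m) Bs)), (map (low m) Bs, map (high m) Bs))) y) = y"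
      unfolding y prod.case Us_def [symmetric] Vs_def [symmetric] join c by simp
    have cu: "concat Us = u" and cv: "concat Vs = v"
      using w unfolding shuffles_low_high[OF u v] Us_def Vs_def low_concat [symmetric] high_concat [symmetric] c
      by auto
    have NU: "length Us = N" "length Vs = N" using NB by (simp_all add: Us_def Vs_def)
    have EU: "exponents N (?E Us) = map length Us" "exponents N (?E Vs) = map length Vs"
      using exponents_nth[of "map length Us"] exponents_nth[of "map length Vs"] NU by simp_all
    have sub: "sorted (filter Q B)" if "B \<in> set Bs" for Q B
      using s that by (simp add: sorted_wrt_filter)
    have "Us \<in> ?I (?E Us) u" "Vs \<in> ?I (?E Vs) v"
      unfolding increasing_blocks_def EU using cu cv sub
      by (auto simp: Us_def Vs_def low_def high_def)
    moreover have "?E Us + ?E Vs = e"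
    proof (rule exponents_inject[of _ N])
      show "Poly_Mapping.keys (?E Us + ?E Vs) \<subseteq> {..<N}"
        using keys_nth[of "map length Us"] keys_nth[of "map length Vs"]
          Poly_Mapping.keys_add[of "?E Us" "?E Vs"]
        unfolding length_map NU by blast
      have "exponents N (?E Us + ?E Vs) = map2 (+) (map length Us) (map length Vs)"
        unfolding exponents_add EU ..
      also have "\<dots> = map length (map2 (@) Us Vs)"
        by (rule nth_equalityI) auto
      also have "\<dots> = exponents N e" unfolding join l ..
      finally show "exponents N (?E Us + ?E Vs) = exponents N e" .
    qed (rule e)
    ultimately show "(\<lambda>(w, Bs). ((?E (map (low m) Bs), ?E (map (high m) Bs)), (map (low m) Bs, map (high m) Bs))) y \<in> ?L"
      unfolding y prod.case Us_def [symmetric] Vs_def [symmetric] by simp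
  qed
  also have "\<dots> = (\<Sum>w\<in>shuffles u v. \<Sum>Bs\<in>?I e w. F (map (low m) Bs) (map (high m) Bs))"
    by (rule sum.Sigma [symmetric]) auto
  finally show ?thesis .
qed


section \<open>The product rule\<close>

lemma Des_shift [simp]: "Des (shift m v) = Des v"
  by (auto simp: Des_def shift_def)

theorem theorem5p5:
  fixes m n :: nat and I J :: "nat set" and u v :: "nat list"
  assumes "I \<subseteq> {1..<m}" and "J \<subseteq> {1..<n}"
    and "u \<in> permutations_of_set {1..m}" and "v \<in> permutations_of_set {1..n}"
    and "Des u = I" and "Des v = J"
  shows "G_fun m I * G_fun n J =
    (\<Sum>w \<in> shuffles u (shift m v).
       c_coeff m I J w \<cdot>\<^sub>c
       (\<Sum>K | Des w \<subseteq> K \<and> K \<subseteq> {1..<m + n}.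
          (\<Prod>i \<in> K - Des w. q ^ wt K i - sw m w i) \<cdot>\<^sub>c G_fun (m + n) K))"
proof (rule mfps_ext)
  fix e :: "nat \<Rightarrow>\<^sub>0 nat"
  let ?v = "shift m v"
  obtain N where N: "Poly_Mapping.keys e \<subseteq> {..<N}"
    using finite_nat_set_iff_bounded[of "Poly_Mapping.keys e"] by auto
  let ?I = "\<lambda>e. increasing_blocks (exponents N e)"
  let ?lf = "\<lambda>x. last_factor (ascent_factor x)"
  have u: "distinct u" "set u = {1..m}" "length u = m"
    using assms(3) by (auto simp: permutations_of_set_def dest: distinct_card)
  have v: "distinct ?v" "set ?v = {m + 1..m + n}" "length ?v = n"
    using assms(4) distinct_card[of v]
    by (auto simp: permutations_of_set_def shift_def distinct_map add.commute)
  have "mfps_nth (G_fun m I * G_fun n J) e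
      = (\<Sum>(a, b) | a + b = e. (\<Sum>Us\<in>?I a u. \<Prod>U\<leftarrow>Us. ?lf u U) * (\<Sum>Vs\<in>?I b ?v. \<Prod>V\<leftarrow>Vs. ?lf ?v V))"
    unfolding mfps_nth_times
  proof (rule sum.cong [OF refl], clarify)
    fix a b assume "e = a + b"
    then have "Poly_Mapping.keys a \<subseteq> {..<N}" "Poly_Mapping.keys b \<subseteq> {..<N}"
      using keys_summand[of a b e] N by blast+
    then show "mfps_nth (G_fun m I) a * mfps_nth (G_fun n J) b
        = (\<Sum>Us\<in>?I a u. \<Prod>U\<leftarrow>Us. ?lf u U) * (\<Sum>Vs\<in>?I b ?v. \<Prod>V\<leftarrow>Vs. ?lf ?v V)"
      using mfps_nth_G_fun[OF u(1), of a N] mfps_nth_G_fun[OF v(1), of b N] u(3) v(3) assms(5,6) by simp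
  qed
  also have "\<dots> = (\<Sum>(a, b) | a + b = e. \<Sum>Us\<in>?I a u. \<Sum>Vs\<in>?I b ?v.
      (\<Prod>U\<leftarrow>Us. ?lf u U) * (\<Prod>V\<leftarrow>Vs. ?lf ?v V))"
    by (simp only: sum_product)
  also have "\<dots> = (\<Sum>w\<in>shuffles u ?v. \<Sum>Bs\<in>?I e w.
      (\<Prod>U\<leftarrow>map (low m) Bs. ?lf u U) * (\<Prod>V\<leftarrow>map (high m) Bs. ?lf ?v V))"
    by (rule sum_pairs_of_blocks) (use u v N in auto)
  also have "\<dots> = (\<Sum>w\<in>shuffles u ?v. c_coeff m I J w *
      mfps_nth (\<Sum>K | Des w \<subseteq> K \<and> K \<subseteq> {1..<m + n}.
          (\<Prod>i \<in> K - Des w. q ^ wt K i - sw m w i) \<cdot>\<^sub>c G_fun (m + n) K) e)"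
  proof (rule sum.cong [OF refl])
    fix w assume w: "w \<in> shuffles u ?v"
    have low: "low m w = u" and high: "high m w = ?v"
      using w shuffles_low_high[of u m ?v w] u v by auto
    have len: "length w = m + n" using length_shuffles[OF w] u v by simp
    have dist: "distinct w" using w u v by (intro distinct_disjoint_shuffles[OF _ _ _ w]) auto
    have set: "0 \<notin> set w" using set_shuffles[OF w] u v by auto
    let ?es = "exponents N e"
    let ?F = "\<Prod>i \<in> psums ?es \<inter> {1..<m + n} - Des w. 1 - sw m w i"
    have D: "Des w \<subseteq> {1..<m + n}" using Des_subset[of w] len by simp
    have "c_coeff m I J w * mfps_nth (\<Sum>K | Des w \<subseteq> K \<and> K \<subseteq> {1..<m + n}.
          (\<Prod>i \<in> K - Des w. q ^ wt K i - sw m w i) \<cdot>\<^sub>c G_fun (m + n) K) e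
        = c_coeff m I J w * (of_bool (sum_list ?es = length w \<and> Des w \<subseteq> psums ?es) * ?F)"
      unfolding sum_G_fun_eq_weighted_L [OF D] mfps_nth_weighted_L [OF D N] len ..
    also have "\<dots> = (\<Sum>Bs\<in>?I e w. c_coeff m I J w * ?F)"
      unfolding sum_increasing_blocks by (simp add: mult_ac)
    also have "\<dots> = (\<Sum>Bs\<in>?I e w.
      (\<Prod>U\<leftarrow>map (low m) Bs. ?lf u U) * (\<Prod>V\<leftarrow>map (high m) Bs. ?lf ?v V))"
    proof (rule sum.cong [OF refl])
      fix Bs assume Bs: "Bs \<in> ?I e w"
      have "c_coeff m I J w * ?F = (\<Prod>B\<leftarrow>Bs. last_factor (shuffle_factor m w) (low m B) *
          last_factor (shuffle_factor m w) (high m B))"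
        using shuffle_weight_blocks[OF dist set Bs, of m] low high len assms(5,6) by simp
      also have "\<dots> = (\<Prod>B\<leftarrow>Bs. ?lf u (low m B) * ?lf ?v (high m B))"
      proof -
        have "last_factor (shuffle_factor m w) (low m B) = ?lf u (low m B)" for B
        proof (cases "low m B = []")
          case False
          then have "last (low m B) \<in> set (low m B)" by simp
          then have "last (low m B) \<le> m" by (simp add: low_def)
          then show ?thesis by (simp add: last_factor_def shuffle_factor_def low)
        qed (simp add: last_factor_def)
        moreover have "last_factor (shuffle_factor m w) (high m B) = ?lf ?v (high m B)" for B
        proof (cases "high m B = []")
          case False
          then have "last (high m B) \<in> set (high m B)" by simp
          then have "\<not> last (high m B) \<le> m" by (simp add: high_def)
          then show ?thesis by (simp add: last_factor_def shuffle_factor_def high)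
        qed (simp add: last_factor_def)
        ultimately show ?thesis by simp
      qed
      also have "\<dots> = (\<Prod>U\<leftarrow>map (low m) Bs. ?lf u U) * (\<Prod>V\<leftarrow>map (high m) Bs. ?lf ?v V)"
        by (simp add: prod_list_map_mult o_def)
      finally show "c_coeff m I J w * ?F
          = (\<Prod>U\<leftarrow>map (low m) Bs. ?lf u U) * (\<Prod>V\<leftarrow>map (high m) Bs. ?lf ?v V)" .
    qed
    finally show "(\<Sum>Bs\<in>?I e w. (\<Prod>U\<leftarrow>map (low m) Bs. ?lf u U) * (\<Prod>V\<leftarrow>map (high m) Bs. ?lf ?v V))
        = c_coeff m I J w * mfps_nth (\<Sum>K | Des w \<subseteq> K \<and> K \<subseteq> {1..<m + n}.
          (\<Prod>i \<in> K - Des w. q ^ wt K i - sw m w i) \<cdot>\<^sub>c G_fun (m + n) K) e"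
      by (rule sym)
  qed
  finally show "mfps_nth (G_fun m I * G_fun n J) e = mfps_nth (\<Sum>w \<in> shuffles u (shift m v).
       c_coeff m I J w \<cdot>\<^sub>c
       (\<Sum>K | Des w \<subseteq> K \<and> K \<subseteq> {1..<m + n}.
          (\<Prod>i \<in> K - Des w. q ^ wt K i - sw m w i) \<cdot>\<^sub>c G_fun (m + n) K)) e"
    unfolding mfps_nth_sum mfps_nth_scale .
qed

end
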